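(* Let $d\ge1$ and let $\mathbb Z^d$ be the standard lattice (unit vertex measure, unit nearest-neighbour edge weights) with Laplacian $\Delta u(x)=\sum_{y\sim x}(u(y)-u(x))$. Let $u\in C_c(\mathbb Z^d)$. Then the Fourier transform of the logarithmic Laplacian of $u$ satisfies $$\widehat{\log(-\Delta)u}(\xi)=\ln\bigl(\Phi(\xi)\bigr)\,\widehat u(\xi),\qquad \xi\in[-\pi,\pi]^d,$$ as an identity in $L^2([-\pi,\pi]^d)$, where $\Phi(\xi)=\sum_{j=1}^d(2-2\cos\xi_j)$.
   Context: $C_c(\mathbb Z^d)$ is the space of finitely supported functions. The Fourier transform is $\widehat u(\xi)=(2\pi)^{-d/2}\sum_{x\in\mathbb Z^d}u(x)e^{-ix\cdot\xi}$, extended to a unitary map $\ell^2(\mathbb Z^d)\to L^2([-\pi,\pi]^d)$. The logarithmic Laplacian of $u\in C_c(\mathbb Z^d)$ is given by $$(\log(-\Delta)u)(x)=\int_0^\infty\frac{e^{-t}u(x)-(e^{t\Delta}u)(x)}{t}\,dt ,\qquad x\in\mathbb Z^d,$$ where $e^{t\Delta}$ is the heat semigroup of the bounded operator $\Delta$; the function $\log(-\Delta)u$ belongs to $\ell^2(\mathbb Z^d)$ and equals the limit of $\frac{(-\Delta)^su-u}{s}$ in $\ell^2(\mathbb Z^d)$ as $s\to0^+$, with $(-\Delta)^su=\frac{s}{\Gamma(1-s)}\int_0^\infty(u-e^{t\Delta}u)\,t^{-1-s}\,dt$. *)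

theory Defs
  imports "HOL-Analysis.Analysis"
begin

text \<open>The lattice is the type \<open>int ^ 'd\<close>, of dimension \<open>CARD('d) \<ge> 1\<close>. Functions on it are
  complex-valued.\<close>

definition neighbours :: "int ^ 'd \<Rightarrow> (int ^ 'd) set" where
  "neighbours x = {y. (\<Sum>j\<in>UNIV. \<bar>x $ j - y $ j\<bar>) = 1}"

definition laplacian :: "(int ^ 'd \<Rightarrow> complex) \<Rightarrow> int ^ 'd \<Rightarrow> complex" where
  "laplacian u x = (\<Sum>y\<in>neighbours x. u y - u x)"

definition finitely_supported :: "('a \<Rightarrow> complex) \<Rightarrow> bool" where
  "finitely_supported u \<longleftrightarrow> finite {x. u x \<noteq> 0}"

text \<open>The exponential series of the bounded operator \<open>t \<Delta>\<close>, evaluated at a point. For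
  square-summable \<open>u\<close> the series converges in \<open>\<ell>\<^sup>2\<close>, hence pointwise to the same function.\<close>

definition heat :: "real \<Rightarrow> (int ^ 'd \<Rightarrow> complex) \<Rightarrow> int ^ 'd \<Rightarrow> complex" where
  "heat t u x = (\<Sum>n. (t ^ n / fact n) *\<^sub>R (laplacian ^^ n) u x)"

definition log_laplacian :: "(int ^ 'd \<Rightarrow> complex) \<Rightarrow> int ^ 'd \<Rightarrow> complex" where
  "log_laplacian u x = (LBINT t:{0<..}. (exp (- t) *\<^sub>R u x - heat t u x) /\<^sub>R t)"

definition square_integrable :: "'a measure \<Rightarrow> ('a \<Rightarrow> complex) \<Rightarrow> bool" where
  "square_integrable M f \<longleftrightarrow> f \<in> borel_measurable M \<and> integrable M (\<lambda>x. (cmod (f x))\<^sup>2)"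

definition L2_norm :: "'a measure \<Rightarrow> ('a \<Rightarrow> complex) \<Rightarrow> real" where
  "L2_norm M f = sqrt (\<integral>x. (cmod (f x))\<^sup>2 \<partial>M)"

text \<open>\<open>\<ell>\<^sup>2\<close> of the lattice is the case \<open>M = count_space UNIV\<close> (unit vertex measure).\<close>

abbreviation lattice_measure :: "(int ^ 'd) measure" where
  "lattice_measure \<equiv> count_space UNIV"

definition torus_measure :: "(real ^ 'd) measure" where
  "torus_measure = lebesgue_on {\<xi>. \<forall>j. \<xi> $ j \<in> {- pi..pi}}"

text \<open>The defining formula of the Fourier transform, for finitely supported \<open>u\<close> only.\<close>

definition fourier :: "(int ^ 'd \<Rightarrow> complex) \<Rightarrow> real ^ 'd \<Rightarrow> complex" where
  "fourier u \<xi> = of_real ((2 * pi) powr (- (real CARD('d) / 2))) *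
     (\<Sum>x | u x \<noteq> 0. u x * exp (- \<i> * of_real (\<Sum>j\<in>UNIV. of_int (x $ j) * \<xi> $ j)))"

text \<open>The unitary extension \<open>\<ell>\<^sup>2 \<rightarrow> L\<^sup>2\<close>, as a relation: \<open>g\<close> represents the image of \<open>f\<close> under the
  extension by continuity of \<open>fourier\<close> from the dense subspace of finitely supported functions.
  Truncations of \<open>f\<close> give an approximating sequence, so \<open>g\<close> is unique up to null sets.\<close>

definition has_fourier_transform :: "(int ^ 'd \<Rightarrow> complex) \<Rightarrow> (real ^ 'd \<Rightarrow> complex) \<Rightarrow> bool" where
  "has_fourier_transform f g \<longleftrightarrow>
     square_integrable lattice_measure f \<and> square_integrable torus_measure g \<and>
     (\<forall>v. (\<forall>n. finitely_supported (v n)) \<and>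
          (\<lambda>n::nat. L2_norm lattice_measure (\<lambda>x. v n x - f x)) \<longlonglongrightarrow> 0 \<longrightarrow>
          (\<lambda>n. L2_norm torus_measure (\<lambda>\<xi>. fourier (v n) \<xi> - g \<xi>)) \<longlonglongrightarrow> 0)"

definition symbol :: "real ^ 'd \<Rightarrow> real" where
  "symbol \<xi> = (\<Sum>j\<in>UNIV. 2 - 2 * cos (\<xi> $ j))"

end

theory Submission
  imports Defs
begin

text \<open>
  On the Fourier side the Laplacian is multiplication by \<open>- symbol \<xi>\<close>, so the heat semigroup is
  multiplication by \<open>exp (- (t * symbol \<xi>))\<close>. Frullani's integral of
  \<open>(exp (- t) - exp (- (a * t))) / t\<close> over \<open>t > 0\<close> equals \<open>ln a\<close>. Taking \<open>a = symbol \<xi>\<close>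
  and exchanging the integrals over \<open>t\<close> and \<open>\<xi>\<close> shows that the values of the logarithmic Laplacian
  are the Fourier coefficients of \<open>g \<xi> = ln (symbol \<xi>) * fourier u \<xi>\<close>
  (lemma \<open>log_laplacian_eq_integral\<close>). The exchange is legitimate because the Frullani kernel has
  constant sign in \<open>t\<close>, so that its absolute integral is \<open>\<bar>ln (symbol \<xi>)\<bar>\<close>, and because
  \<open>(ln (symbol \<xi>))\<^sup>2\<close> is integrable over the torus: the symbol vanishes only at the origin, and there
  only quadratically (lemma \<open>integrable_ln_symbol_square\<close>).

  To be the Fourier transform means more than to have the right coefficients: the transforms of every
  approximating sequence must converge to \<open>g\<close> in \<open>L\<^sup>2\<close>. In general this is the completeness of the
  exponentials. For this particular \<open>g\<close> an explicit approximation is available: the Taylor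
  polynomials of \<open>ln\<close> around an upper bound of the symbol, applied to the operator
  \<open>- laplacian\<close>, map \<open>u\<close> to finitely supported functions whose transforms converge to \<open>g\<close> by dominated
  convergence (lemma \<open>L2_approximation\<close>). Bessel's inequality and Parseval's identity for finite
  sums, which only need orthonormality, then give the convergence for all other sequences
  (lemma \<open>has_fourier_transformI\<close>).
\<close>

section \<open>The torus and its characters\<close>

definition torus :: "(real ^ 'd) set" where
  "torus = {\<xi>. \<forall>j. \<xi> $ j \<in> {- pi..pi}}"

text \<open>Lebesgue measure on the torus before completion. Product measures and Fubini's theorem ask for
  Borel measurability; the integrals of Borel functions agree with those of \<^const>\<open>torus_measure\<close>
  by the lemma \<open>torus_measure_borel\<close> below.\<close>

definition torus_borel :: "(real ^ 'd) measure" where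
  "torus_borel = restrict_space lborel torus"

lemma torus_cbox: "torus = cbox (\<chi> j. - pi) (\<chi> j. pi)"
  by (auto simp: torus_def mem_box_cart)

lemma torus_sets [measurable, simp]: "torus \<in> sets borel"
  by (simp add: torus_cbox)

lemma space_torus_borel [simp]: "space torus_borel = torus"
  by (simp add: torus_borel_def space_restrict_space)

lemma borel_measurable_torus_borel:
  "f \<in> borel_measurable borel \<Longrightarrow> f \<in> measurable torus_borel borel"
  unfolding torus_borel_def by (rule measurable_restrict_space1) simp

lemma finite_measure_torus_borel: "finite_measure (torus_borel :: (real^'d) measure)"
proof (rule finite_measureI)
  have "emeasure torus_borel (space (torus_borel :: (real^'d) measure)) 
      = emeasure lborel (torus :: (real^'d) set)"
    by (simp add: torus_borel_def emeasure_restrict_space space_restrict_space)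
  also have "\<dots> < (\<infinity> :: ennreal)"
    unfolding torus_cbox by (rule emeasure_lborel_cbox_finite)
  finally show "emeasure torus_borel (space (torus_borel :: (real^'d) measure)) \<noteq> \<infinity>" by simp
qed

interpretation torus: finite_measure "torus_borel :: (real^'d) measure"
  by (rule finite_measure_torus_borel)

lemma torus_measure_borel:
  fixes f :: "real ^ 'd \<Rightarrow> 'b :: {banach, second_countable_topology}"
  assumes [measurable]: "f \<in> borel_measurable borel"
  shows integral_torus_measure: "integral\<^sup>L torus_measure f = integral\<^sup>L torus_borel f"
    and integrable_torus_measure: "integrable torus_measure f \<longleftrightarrow> integrable torus_borel f"
proof -
  have eq: "torus_measure = lebesgue_on (torus :: (real^'d) set)"
    by (simp add: torus_measure_def torus_def)
  have [simp]: "torus \<in> sets lebesgue" by (simp add: torus_cbox)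
  show "integral\<^sup>L torus_measure f = integral\<^sup>L torus_borel f"
    unfolding eq torus_borel_def
    by (subst (1 2) integral_restrict_space) (simp_all add: integral_completion)
  show "integrable torus_measure f \<longleftrightarrow> integrable torus_borel f"
    unfolding eq torus_borel_def
    by (subst (1 2) integrable_restrict_space) (simp_all add: integrable_completion)
qed

lemma measurable_torus_measure:
  "f \<in> borel_measurable borel \<Longrightarrow> f \<in> borel_measurable torus_measure"
  unfolding torus_measure_def
  by (intro measurable_restrict_space1 measurable_completion) simp

text \<open>Lebesgue measure is the image of a product of one-dimensional Lebesgue measures under the
  coordinate map, so the integral of a product of functions of single coordinates factors.\<close>

lemma integral_lborel_prod:
  fixes f :: "'a :: euclidean_space \<Rightarrow> real \<Rightarrow> complex"
  assumes "\<And>b. b \<in> Basis \<Longrightarrow> integrable lborel (f b)"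
  shows "(\<integral>x. (\<Prod>b\<in>Basis. f b (x \<bullet> b)) \<partial>lborel) = (\<Prod>b\<in>Basis. \<integral>t. f b t \<partial>lborel)"
proof -
  interpret product_sigma_finite "\<lambda>b::'a. lborel :: real measure" by standard
  have [measurable]: "f b \<in> borel_measurable borel" if "b \<in> Basis" for b
    using borel_measurable_integrable[OF assms[OF that]] by (simp only: measurable_lborel2)
  have "(\<integral>x. (\<Prod>b\<in>Basis. f b (x \<bullet> b)) \<partial>lborel) =
    (\<integral>x. (\<Prod>b\<in>Basis. f b ((\<Sum>c\<in>Basis. x c *\<^sub>R c) \<bullet> b)) \<partial>(\<Pi>\<^sub>M b\<in>(Basis::'a set). lborel))"
    by (subst lborel_eq) (simp add: integral_distr)
  also have "\<dots> = (\<integral>x. (\<Prod>b\<in>Basis. f b (x b)) \<partial>(\<Pi>\<^sub>M b\<in>(Basis::'a set). lborel))"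
    by (intro Bochner_Integration.integral_cong prod.cong) (simp_all)
  also have "\<dots> = (\<Prod>b\<in>Basis. \<integral>t. f b t \<partial>lborel)"
    by (rule product_integral_prod) (simp_all add: assms)
  finally show ?thesis .
qed

lemma integral_lborel_prod_cart:
  fixes f :: "'d :: finite \<Rightarrow> real \<Rightarrow> complex"
  assumes "\<And>j. integrable lborel (f j)"
  shows "(\<integral>x. (\<Prod>j\<in>UNIV. f j (x $ j)) \<partial>lborel) = (\<Prod>j\<in>UNIV. \<integral>t. f j t \<partial>lborel)"
proof -
  have inj: "inj (\<lambda>j::'d. axis j (1::real))" by (auto simp: inj_def axis_eq_axis)
  have Basis: "(Basis :: (real^'d) set) = (\<lambda>j. axis j 1) ` UNIV" by (auto simp: Basis_vec_def)
  have prod: "(\<Prod>b\<in>Basis. h b) = (\<Prod>j\<in>UNIV. h (axis j 1))" for h :: "real^'d \<Rightarrow> complex"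
    unfolding Basis by (subst prod.reindex[OF inj]) simp
  show ?thesis
    using integral_lborel_prod[of "\<lambda>b. f (inv (\<lambda>j. axis j (1::real)) b)"] assms
    by (simp add: prod inv_f_f[OF inj] inner_axis)
qed

lemma integral_exp_period:
  fixes k :: int
  defines "f \<equiv> (\<lambda>t::real. indicator {-pi..pi} t *\<^sub>R exp (- \<i> * of_real (of_int k * t)))"
  shows "integrable lborel f"
    and "integral\<^sup>L lborel f = (if k = 0 then of_real (2 * pi) else 0)"
proof -
  let ?e = "\<lambda>t::real. exp (- \<i> * of_real (of_int k * t)) :: complex"
  have cont: "continuous_on {-pi..pi} ?e" by (intro continuous_intros)
  show "integrable lborel f"
    unfolding f_def using borel_integrable_compact[OF _ cont] by simp
  show "integral\<^sup>L lborel f = (if k = 0 then of_real (2 * pi) else 0)"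
  proof (cases "k = 0")
    case True
    then show ?thesis by (simp add: f_def scaleR_conv_of_real)
  next
    case False
    have "integral\<^sup>L lborel f = (\<lambda>t. \<i> / of_int k * ?e t) pi - (\<lambda>t. \<i> / of_int k * ?e t) (- pi)"
      unfolding f_def
    proof (rule integral_FTC_Icc[OF _ _ cont])
      show "((\<lambda>t. \<i> / of_int k * ?e t) has_vector_derivative ?e x) (at x within {-pi..pi})" for x
      proof -
        have "((\<lambda>t. (\<lambda>z. \<i> / of_int k * exp (- \<i> * (of_int k * z))) (of_real t)) has_vector_derivative
            exp (- \<i> * (of_int k * of_real x))) (at x within {-pi..pi})"
          using False
          by (intro has_vector_derivative_real_field)
             (auto intro!: derivative_eq_intros simp: field_simps)
        then show ?thesis by simp
      qed
    qed simp
    also have "?e pi = ?e (-pi)"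
      using exp_plus_2pin[of "- \<i> * of_real (of_int k * pi)" k]
      by (simp add: algebra_simps)
    finally show ?thesis using False by simp
  qed
qed

text \<open>The orthonormal exponentials: \<open>fourier u\<close> is the sum of \<open>u x * character x\<close>.\<close>

definition character :: "int ^ 'd \<Rightarrow> real ^ 'd \<Rightarrow> complex" where
  "character x \<xi> = of_real ((2 * pi) powr (- (real CARD('d) / 2))) *
     exp (- \<i> * of_real (\<Sum>j\<in>UNIV. of_int (x $ j) * \<xi> $ j))"

lemma continuous_on_character [continuous_intros]: "continuous_on A (character x)"
  unfolding character_def by (intro continuous_intros)

lemma borel_measurable_character [measurable]: "character x \<in> borel_measurable borel"
  by (intro borel_measurable_continuous_onI continuous_intros)

lemma norm_character: "cmod (character (x :: int^'d) \<xi>) = (2 * pi) powr (- (real CARD('d) / 2))"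
proof -
  have "exp (- \<i> * of_real r) = cis (- r)" for r by (simp add: cis_conv_exp)
  then show ?thesis unfolding character_def norm_mult by (simp only: norm_cis) simp
qed

text \<open>Orthonormality. The integrand is a product over the coordinates, and the factor of a coordinate in
  which \<open>x\<close> and \<open>y\<close> differ integrates to \<open>0\<close> over a full period; if there is none, the volume
  \<open>(2 * pi) ^ CARD('d)\<close> cancels the normalising constant.\<close>

lemma integral_character:
  fixes x y :: "int ^ 'd"
  shows "(\<integral>\<xi>. character x \<xi> * cnj (character y \<xi>) \<partial>torus_borel) = (if x = y then 1 else 0)"
proof -
  define c where "c = (2 * pi) powr (- real CARD('d))"
  define f where "f = (\<lambda>j t. indicator {-pi..pi} t *\<^sub>R exp (- \<i> * of_real (of_int (x $ j - y $ j) * t)))"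
  have c: "c = (2 * pi) powr (- (real CARD('d) / 2)) * (2 * pi) powr (- (real CARD('d) / 2))"
    by (simp add: c_def flip: powr_add)
  have ind: "indicator torus \<xi> = (\<Prod>j\<in>UNIV. indicator {-pi..pi} (\<xi> $ j) :: real)" for \<xi> :: "real^'d"
    by (auto simp: torus_def indicator_def)
  have eq: "indicator torus \<xi> *\<^sub>R (character x \<xi> * cnj (character y \<xi>)) 
      = of_real c * (\<Prod>j\<in>UNIV. f j (\<xi> $ j))" for \<xi>
  proof -
    have "character x \<xi> * cnj (character y \<xi>) = of_real c *
       exp (- \<i> * of_real (\<Sum>j\<in>UNIV. of_int (x $ j) * \<xi> $ j) + \<i> * of_real (\<Sum>j\<in>UNIV. of_int (y $ j) * \<xi> $ j))"
      by (simp add: character_def c exp_cnj flip: exp_add)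
    also have "- \<i> * of_real (\<Sum>j\<in>UNIV. of_int (x $ j) * \<xi> $ j) + \<i> * of_real (\<Sum>j\<in>UNIV. of_int (y $ j) * \<xi> $ j)
       = (\<Sum>j\<in>UNIV. - \<i> * of_real (of_int (x $ j - y $ j) * \<xi> $ j))"
      by (simp add: sum_distrib_left algebra_simps flip: sum.distrib sum_subtractf)
    also have "exp \<dots> = (\<Prod>j\<in>UNIV. exp (- \<i> * of_real (of_int (x $ j - y $ j) * \<xi> $ j)))"
      by (simp add: exp_sum)
    finally show ?thesis
      by (simp add: f_def ind scaleR_conv_of_real prod.distrib mult_ac)
  qed
  have "(\<integral>\<xi>. character x \<xi> * cnj (character y \<xi>) \<partial>torus_borel)
      = of_real c * (\<integral>\<xi>. (\<Prod>j\<in>UNIV. f j (\<xi> $ j)) \<partial>lborel)"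
    unfolding torus_borel_def by (subst integral_restrict_space) (simp_all add: eq)
  also have "\<dots> = of_real c * (\<Prod>j\<in>UNIV. if x $ j - y $ j = 0 then of_real (2 * pi) else 0)"
    unfolding f_def by (subst integral_lborel_prod_cart) (simp_all only: integral_exp_period)
  also have "\<dots> = (if x = y then 1 else 0)"
  proof (cases "x = y")
    case True
    have "c * (2 * pi) ^ CARD('d) = 1"
      by (simp add: c_def powr_minus powr_realpow field_simps)
    then have "complex_of_real (c * (2 * pi) ^ CARD('d)) = 1" by (simp only: of_real_1)
    with True show ?thesis by simp
  next
    case False
    then obtain j where "x $ j \<noteq> y $ j" by (auto simp: vec_eq_iff)
    then show ?thesis using False by (auto intro!: prod_zero)
  qed
  finally show ?thesis .
qed

lemma torus_integrable_bounded:
  fixes f :: "real ^ 'd \<Rightarrow> 'b :: {banach, second_countable_topology}"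
  assumes "f \<in> borel_measurable borel" "\<And>\<xi>. norm (f \<xi>) \<le> B"
  shows "integrable torus_borel f"
  using assms by (intro torus.integrable_const_bound[where B = B] borel_measurable_torus_borel) auto

section \<open>Fourier sums, Bessel's inequality and Parseval's identity\<close>

lemma fourier_eq_sum:
  assumes "finite S" "{x. u x \<noteq> 0} \<subseteq> S"
  shows "fourier u \<xi> = (\<Sum>x\<in>S. u x * character x \<xi>)"
proof -
  have "fourier u \<xi> = (\<Sum>x | u x \<noteq> 0. u x * character x \<xi>)"
    by (simp add: fourier_def character_def sum_distrib_left mult_ac)
  also have "\<dots> = (\<Sum>x\<in>S. u x * character x \<xi>)"
    using assms by (intro sum.mono_neutral_left) auto
  finally show ?thesis .
qed

lemma fourier_eq_sum_support: 
  "finitely_supported u \<Longrightarrow> fourier u \<xi> = (\<Sum>x | u x \<noteq> 0. u x * character x \<xi>)"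
  by (rule fourier_eq_sum) (auto simp: finitely_supported_def)

lemma borel_measurable_fourier [measurable]: "fourier u \<in> borel_measurable borel"
  unfolding fourier_def by (intro borel_measurable_continuous_onI continuous_intros)

lemma norm_fourier_le:
  fixes u :: "int ^ 'd \<Rightarrow> complex"
  obtains B where "B \<ge> 0" "\<And>\<xi>. cmod (fourier u \<xi>) \<le> B"
proof
  let ?c = "(2 * pi) powr (- (real CARD('d) / 2))"
  show "?c * (\<Sum>x | u x \<noteq> 0. cmod (u x)) \<ge> 0" by (simp add: sum_nonneg)
  show "cmod (fourier u \<xi>) \<le> ?c * (\<Sum>x | u x \<noteq> 0. cmod (u x))" for \<xi>
  proof -
    have "fourier u \<xi> = (\<Sum>x | u x \<noteq> 0. u x * character x \<xi>)"
      by (simp add: fourier_def character_def sum_distrib_left mult_ac)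
    also have "cmod \<dots> \<le> (\<Sum>x | u x \<noteq> 0. cmod (u x) * ?c)"
      by (rule order_trans[OF norm_sum]) (simp add: norm_mult norm_character)
    finally show ?thesis by (simp add: sum_distrib_right mult_ac)
  qed
qed

lemma borel_measurable_cnj_character [measurable]:
  "(\<lambda>\<xi>. cnj (character x \<xi>)) \<in> borel_measurable borel"
  by (intro borel_measurable_continuous_onI continuous_intros)

lemma integrable_character_mult_cnj:
  fixes x y :: "int ^ 'd"
  shows "integrable torus_borel (\<lambda>\<xi>. character x \<xi> * cnj (character y \<xi>))"
proof -
  let ?c = "(2 * pi) powr (- (real CARD('d) / 2))"
  have "(\<lambda>\<xi>. character x \<xi> * cnj (character y \<xi>)) \<in> borel_measurable borel" by measurable
  then show ?thesis by (rule torus_integrable_bounded[where B = "?c * ?c"]) (simp add: norm_mult norm_character)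
qed

lemma integrable_of_square_integrable:
  fixes h :: "real ^ 'd \<Rightarrow> complex"
  assumes [measurable]: "h \<in> borel_measurable borel"
    and h2: "integrable torus_borel (\<lambda>\<xi>. (cmod (h \<xi>))\<^sup>2)"
  shows "integrable torus_borel h"
proof (rule Bochner_Integration.integrable_bound)
  show "integrable torus_borel (\<lambda>\<xi>. 1 + (cmod (h \<xi>))\<^sup>2)"
    using h2 by (intro Bochner_Integration.integrable_add) simp_all
  show "h \<in> borel_measurable torus_borel" by (rule borel_measurable_torus_borel) fact
  \<comment> \<open>The constant \<open>1\<close> in the dominating function is integrable because the torus has finite measure.\<close>
  have "r \<le> 1 + r\<^sup>2" for r :: real
    using zero_le_power2[of "r - 1/2"] by (simp add: power2_eq_square algebra_simps)
  then show "AE \<xi> in torus_borel. norm (h \<xi>) \<le> norm (1 + (cmod (h \<xi>))\<^sup>2)"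
    by (auto simp: abs_of_nonneg add_nonneg_nonneg)
qed

lemma integrable_mult_character:
  fixes h :: "real ^ 'd \<Rightarrow> complex"
  assumes [measurable]: "h \<in> borel_measurable borel" and h: "integrable torus_borel h"
  shows "integrable torus_borel (\<lambda>\<xi>. h \<xi> * cnj (character x \<xi>))"
proof (rule Bochner_Integration.integrable_bound)
  let ?c = "(2 * pi) powr (- (real CARD('d) / 2))"
  show "integrable torus_borel (\<lambda>\<xi>. ?c *\<^sub>R h \<xi>)" using h by simp
  show "(\<lambda>\<xi>. h \<xi> * cnj (character x \<xi>)) \<in> borel_measurable torus_borel"
    by (rule borel_measurable_torus_borel) measurable
qed (simp add: norm_mult norm_character)

lemma integral_norm_character_sum:
  fixes a :: "int ^ 'd \<Rightarrow> complex"
  assumes "finite F"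
  shows "(\<integral>\<xi>. (cmod (\<Sum>x\<in>F. a x * character x \<xi>))\<^sup>2 \<partial>torus_borel) = (\<Sum>x\<in>F. (cmod (a x))\<^sup>2)"
proof -
  have "complex_of_real ((cmod (\<Sum>x\<in>F. a x * character x \<xi>))\<^sup>2) =
      (\<Sum>x\<in>F. \<Sum>y\<in>F. a x * cnj (a y) * (character x \<xi> * cnj (character y \<xi>)))" for \<xi>
    unfolding complex_norm_square cnj_sum sum_product by (simp add: mult_ac)
  then have "complex_of_real (\<integral>\<xi>. (cmod (\<Sum>x\<in>F. a x * character x \<xi>))\<^sup>2 \<partial>torus_borel)
     = (\<integral>\<xi>. (\<Sum>x\<in>F. \<Sum>y\<in>F. a x * cnj (a y) * (character x \<xi> * cnj (character y \<xi>))) \<partial>torus_borel)"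
    by (simp flip: integral_complex_of_real)
  also have "\<dots> = (\<Sum>x\<in>F. \<Sum>y\<in>F. a x * cnj (a y) * (if x = y then 1 else 0))"
    by (simp add: integral_character integrable_character_mult_cnj)
  also have "\<dots> = complex_of_real (\<Sum>x\<in>F. (cmod (a x))\<^sup>2)"
    using assms by (simp add: if_distrib complex_norm_square cong: if_cong del: of_real_power)
  finally show ?thesis by (simp only: of_real_eq_iff)
qed

text \<open>Expand the square norm of \<open>h - S\<close>, where \<open>S\<close> is the partial sum of the Fourier series of \<open>h\<close>
  over \<open>F\<close>: by orthonormality the cross term and the square norm of \<open>S\<close> are both the sum on the
  left, and the total is nonnegative.\<close>

lemma bessel_inequality:
  fixes h :: "real ^ 'd \<Rightarrow> complex" and F :: "(int ^ 'd) set"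
  assumes [measurable]: "h \<in> borel_measurable borel"
    and h2: "integrable torus_borel (\<lambda>\<xi>. (cmod (h \<xi>))\<^sup>2)" and "finite F"
  shows "(\<Sum>x\<in>F. (cmod (\<integral>\<xi>. h \<xi> * cnj (character x \<xi>) \<partial>torus_borel))\<^sup>2)
     \<le> (\<integral>\<xi>. (cmod (h \<xi>))\<^sup>2 \<partial>torus_borel)"
proof -
  define c where "c = (\<lambda>x. \<integral>\<xi>. h \<xi> * cnj (character x \<xi>) \<partial>torus_borel)"
  define S where "S = (\<lambda>\<xi>. \<Sum>x\<in>F. c x * character x \<xi>)"
  have [measurable]: "S \<in> borel_measurable borel" unfolding S_def by measurable
  have int: "integrable torus_borel (\<lambda>\<xi>. h \<xi> * cnj (character x \<xi>))" for x
    by (intro integrable_mult_character integrable_of_square_integrable h2) fact+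
  have hS: "(\<lambda>\<xi>. h \<xi> * cnj (S \<xi>)) = (\<lambda>\<xi>. \<Sum>x\<in>F. cnj (c x) * (h \<xi> * cnj (character x \<xi>)))"
    by (simp add: S_def sum_distrib_left mult_ac)
  have intS: "integrable torus_borel (\<lambda>\<xi>. h \<xi> * cnj (S \<xi>))"
    unfolding hS using int by simp
  have "(\<integral>\<xi>. h \<xi> * cnj (S \<xi>) \<partial>torus_borel) = (\<Sum>x\<in>F. cnj (c x) * c x)"
    unfolding hS using int by (simp add: c_def)
  also have "\<dots> = of_real (\<Sum>x\<in>F. (cmod (c x))\<^sup>2)"
    by (simp add: complex_norm_square mult_ac del: of_real_power)
  finally have hS_integral: "(\<integral>\<xi>. h \<xi> * cnj (S \<xi>) \<partial>torus_borel) = of_real (\<Sum>x\<in>F. (cmod (c x))\<^sup>2)" .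
  define R where "R = (\<lambda>\<xi>. Re (h \<xi> * cnj (S \<xi>)))"
  have intR: "integrable torus_borel R"
    unfolding R_def by (rule integrable_Re[OF intS])
  have cross: "integral\<^sup>L torus_borel R = (\<Sum>x\<in>F. (cmod (c x))\<^sup>2)"
    unfolding R_def integral_Re[OF intS] by (simp only: hS_integral Re_complex_of_real)
  have "cmod (S \<xi>) \<le> (\<Sum>x\<in>F. cmod (c x) * (2 * pi) powr (- (real CARD('d) / 2)))" for \<xi>
    unfolding S_def by (rule order_trans[OF norm_sum]) (simp add: norm_mult norm_character)
  then have S2: "integrable torus_borel (\<lambda>\<xi>. (cmod (S \<xi>))\<^sup>2)"
    by (intro torus_integrable_bounded[where B = "(\<Sum>x\<in>F. cmod (c x) * (2 * pi) powr (- (real CARD('d) / 2)))\<^sup>2"])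
       (auto intro: power_mono)
  have normS: "(\<integral>\<xi>. (cmod (S \<xi>))\<^sup>2 \<partial>torus_borel) = (\<Sum>x\<in>F. (cmod (c x))\<^sup>2)"
    unfolding S_def by (rule integral_norm_character_sum) fact
  have "0 \<le> (\<integral>\<xi>. (cmod (h \<xi> - S \<xi>))\<^sup>2 \<partial>torus_borel)"
    by simp
  also have "(\<lambda>\<xi>. (cmod (h \<xi> - S \<xi>))\<^sup>2) = (\<lambda>\<xi>. (cmod (h \<xi>))\<^sup>2 - 2 * R \<xi> + (cmod (S \<xi>))\<^sup>2)"
    unfolding cmod_power2 by (simp add: R_def fun_eq_iff power2_eq_square algebra_simps)
  also have "integral\<^sup>L torus_borel \<dots> = (\<integral>\<xi>. (cmod (h \<xi>))\<^sup>2 \<partial>torus_borel) - 2 * (\<Sum>x\<in>F. (cmod (c x))\<^sup>2) + (\<Sum>x\<in>F. (cmod (c x))\<^sup>2)"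
    using h2 S2 intR by (simp add: cross normS)
  finally show ?thesis by (simp add: c_def)
qed

lemma fourier_parseval:
  fixes v :: "int ^ 'd \<Rightarrow> complex"
  assumes "finitely_supported v"
  shows "(\<integral>\<xi>. (cmod (fourier v \<xi>))\<^sup>2 \<partial>torus_borel) = (\<integral>x. (cmod (v x))\<^sup>2 \<partial>lattice_measure)"
proof -
  have fin: "finite {x. v x \<noteq> 0}" using assms by (simp add: finitely_supported_def)
  have "(\<integral>\<xi>. (cmod (fourier v \<xi>))\<^sup>2 \<partial>torus_borel) = (\<Sum>x | v x \<noteq> 0. (cmod (v x))\<^sup>2)"
    using integral_norm_character_sum[OF fin, of v] by (simp add: fourier_eq_sum_support assms)
  also have "\<dots> = (\<integral>x. (cmod (v x))\<^sup>2 \<partial>lattice_measure)"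
    using fin by (subst lebesgue_integral_count_space_finite_support) simp_all
  finally show ?thesis .
qed

lemma fourier_inversion:
  fixes v :: "int ^ 'd \<Rightarrow> complex"
  assumes "finitely_supported v"
  shows "(\<integral>\<xi>. fourier v \<xi> * cnj (character x \<xi>) \<partial>torus_borel) = v x"
proof -
  have fin: "finite (insert x {y. v y \<noteq> 0})" using assms by (simp add: finitely_supported_def)
  have "(\<integral>\<xi>. fourier v \<xi> * cnj (character x \<xi>) \<partial>torus_borel)
     = (\<integral>\<xi>. (\<Sum>y\<in>insert x {y. v y \<noteq> 0}. v y * (character y \<xi> * cnj (character x \<xi>))) \<partial>torus_borel)"
    by (subst fourier_eq_sum[OF fin]) (blast, simp only: sum_distrib_right mult.assoc)
  also have "\<dots> = (\<Sum>y\<in>insert x {y. v y \<noteq> 0}. v y * (if y = x then 1 else 0))"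
    by (simp add: integral_character integrable_character_mult_cnj del: sum.insert)
  also have "\<dots> = v x" using fin by (simp add: if_distrib cong: if_cong del: sum.insert)
  finally show ?thesis .
qed

text \<open>Bessel's inequality turns \<open>L\<^sup>2\<close> bounds on the torus into \<open>\<ell>\<^sup>2\<close> bounds for Fourier coefficients on
  the lattice. It makes the logarithmic Laplacian square-summable, and it makes approximations of
  the multiplier in \<open>L\<^sup>2\<close> approximations in \<open>\<ell>\<^sup>2\<close>.\<close>

lemma bessel_lattice:
  fixes h :: "real ^ 'd \<Rightarrow> complex"
  assumes "h \<in> borel_measurable borel" "integrable torus_borel (\<lambda>\<xi>. (cmod (h \<xi>))\<^sup>2)"
  defines "c \<equiv> (\<lambda>x. \<integral>\<xi>. h \<xi> * cnj (character x \<xi>) \<partial>torus_borel)"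
  shows "integrable lattice_measure (\<lambda>x. (cmod (c x))\<^sup>2)"
    and "(\<integral>x. (cmod (c x))\<^sup>2 \<partial>lattice_measure) \<le> (\<integral>\<xi>. (cmod (h \<xi>))\<^sup>2 \<partial>torus_borel)"
proof -
  let ?I = "\<integral>\<xi>. (cmod (h \<xi>))\<^sup>2 \<partial>torus_borel"
  have le: "(\<Sum>x\<in>F. (cmod (c x))\<^sup>2) \<le> ?I" if "finite F" for F
    unfolding c_def by (intro bessel_inequality assms that)
  have summ: "(\<lambda>x. (cmod (c x))\<^sup>2) summable_on UNIV"
    by (rule nonneg_bdd_above_summable_on) (auto intro!: bdd_aboveI2[where M = ?I] le)
  then have "Infinite_Sum.abs_summable_on (\<lambda>x. (cmod (c x))\<^sup>2) UNIV" by simp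
  then have abs: "Infinite_Set_Sum.abs_summable_on (\<lambda>x. (cmod (c x))\<^sup>2) UNIV"
    by (simp only: abs_summable_equivalent)
  then show "integrable lattice_measure (\<lambda>x. (cmod (c x))\<^sup>2)"
    by (simp add: Infinite_Set_Sum.abs_summable_on_def)
  have "(\<integral>x. (cmod (c x))\<^sup>2 \<partial>lattice_measure) = (\<Sum>\<^sub>\<infinity>x. (cmod (c x))\<^sup>2)"
    using infsetsum_infsum[OF abs] by (simp add: infsetsum_def)
  also have "\<dots> \<le> ?I" using summ le by (intro infsum_le_finite_sums) auto
  finally show "(\<integral>x. (cmod (c x))\<^sup>2 \<partial>lattice_measure) \<le> ?I" .
qed

lemma integrable_fourier_square: "integrable torus_borel (\<lambda>\<xi>. (cmod (fourier v \<xi>))\<^sup>2)"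
proof -
  obtain B where B: "\<And>\<xi>. cmod (fourier v \<xi>) \<le> B" using norm_fourier_le by blast
  show ?thesis by (rule torus_integrable_bounded[where B = "B\<^sup>2"]) (auto intro!: power_mono B)
qed

text \<open>A finitely supported function is the family of Fourier coefficients of its own Fourier sum.\<close>

lemma integrable_finitely_supported_square:
  fixes v :: "int ^ 'd \<Rightarrow> complex"
  assumes "finitely_supported v"
  shows "integrable lattice_measure (\<lambda>x. (cmod (v x))\<^sup>2)"
  using bessel_lattice(1)[OF borel_measurable_fourier integrable_fourier_square, of v]
  by (simp add: fourier_inversion assms)

section \<open>The Laplacian as a Fourier multiplier\<close>

lemma finitely_supported_lincomb:
  assumes "finitely_supported u" "finitely_supported v"
  shows "finitely_supported (\<lambda>x. a * u x + b * v x)"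
proof -
  have "{x. a * u x + b * v x \<noteq> 0} \<subseteq> {x. u x \<noteq> 0} \<union> {x. v x \<noteq> 0}" by auto
  with assms show ?thesis unfolding finitely_supported_def by (meson finite_UnI finite_subset)
qed

lemma fourier_lincomb:
  assumes "finitely_supported u" "finitely_supported v"
  shows "fourier (\<lambda>x. a * u x + b * v x) \<xi> = a * fourier u \<xi> + b * fourier v \<xi>"
proof -
  let ?S = "{x. u x \<noteq> 0} \<union> {x. v x \<noteq> 0}"
  have "finite ?S" using assms by (simp add: finitely_supported_def)
  then show ?thesis
    by (subst (1 2 3) fourier_eq_sum[of ?S])
       (auto simp: algebra_simps sum.distrib sum_distrib_left)
qed

lemma finitely_supported_shift:
  fixes u :: "int ^ 'd \<Rightarrow> complex"
  assumes "finitely_supported u"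
  shows "finitely_supported (\<lambda>x. u (x + z))"
proof -
  have "{x. u (x + z) \<noteq> 0} = (\<lambda>y. y - z) ` {y. u y \<noteq> 0}"
    by (auto simp: image_iff) (metis add_diff_cancel)
  with assms show ?thesis by (simp add: finitely_supported_def)
qed

lemma character_add:
  "character (x + z) \<xi> = exp (- \<i> * of_real (\<Sum>j\<in>UNIV. of_int (z $ j) * \<xi> $ j)) * character x \<xi>"
proof -
  have "- \<i> * of_real (\<Sum>j\<in>UNIV. of_int ((x + z) $ j) * \<xi> $ j)
     = - \<i> * of_real (\<Sum>j\<in>UNIV. of_int (z $ j) * \<xi> $ j) + - \<i> * of_real (\<Sum>j\<in>UNIV. of_int (x $ j) * \<xi> $ j)"
    by (simp add: algebra_simps sum.distrib)
  then show ?thesis by (simp only: character_def exp_add mult_ac)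
qed

lemma fourier_shift:
  fixes u :: "int ^ 'd \<Rightarrow> complex"
  assumes "finitely_supported u"
  shows "fourier (\<lambda>x. u (x + z)) \<xi> = exp (\<i> * of_real (\<Sum>j\<in>UNIV. of_int (z $ j) * \<xi> $ j)) * fourier u \<xi>"
proof -
  have eq: "{x. u (x + z) \<noteq> 0} = (\<lambda>y. y - z) ` {y. u y \<noteq> 0}"
    by (auto simp: image_iff) (metis add_diff_cancel)
  have "fourier (\<lambda>x. u (x + z)) \<xi> = (\<Sum>x | u (x + z) \<noteq> 0. u (x + z) * character x \<xi>)"
    by (intro fourier_eq_sum_support finitely_supported_shift assms)
  also have "\<dots> = (\<Sum>y | u y \<noteq> 0. u y * character (y + (- z)) \<xi>)"
    unfolding eq by (subst sum.reindex) (auto simp: inj_on_def)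
  also have "\<dots> = exp (\<i> * of_real (\<Sum>j\<in>UNIV. of_int (z $ j) * \<xi> $ j)) * fourier u \<xi>"
    unfolding character_add
    by (simp add: fourier_eq_sum_support assms sum_distrib_right sum_negf mult_ac)
  finally show ?thesis .
qed

lemma neighbours_eq:
  fixes x :: "int ^ 'd"
  shows "neighbours x = range (\<lambda>j. x + axis j 1) \<union> range (\<lambda>j. x - axis j 1)"
proof (intro set_eqI iffI)
  fix y assume "y \<in> neighbours x"
  then have sum: "(\<Sum>j\<in>UNIV. \<bar>x $ j - y $ j\<bar>) = 1"
    unfolding neighbours_def by (rule CollectD)
  have "\<exists>j. x $ j \<noteq> y $ j"
  proof (rule ccontr)
    assume "\<nexists>j. x $ j \<noteq> y $ j"
    with sum show False by simp
  qed
  then obtain j where j: "x $ j \<noteq> y $ j" ..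
  have "(\<Sum>j\<in>UNIV. \<bar>x $ j - y $ j\<bar>) = \<bar>x $ j - y $ j\<bar> + (\<Sum>i\<in>UNIV - {j}. \<bar>x $ i - y $ i\<bar>)"
    by (rule sum.remove) auto
  moreover have "(\<Sum>i\<in>UNIV - {j}. \<bar>x $ i - y $ i\<bar>) \<ge> 0" by (rule sum_nonneg) simp
  ultimately have one: "\<bar>x $ j - y $ j\<bar> = 1" and zsum: "(\<Sum>i\<in>UNIV - {j}. \<bar>x $ i - y $ i\<bar>) = 0"
    using j sum by linarith+
  have zero: "x $ i = y $ i" if "i \<noteq> j" for i
    using that zsum sum_nonneg_eq_0_iff[of "UNIV - {j}" "\<lambda>i. \<bar>x $ i - y $ i\<bar>"] by simp
  from one consider "y $ j = x $ j + 1" | "y $ j = x $ j - 1" by linarith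
  then show "y \<in> range (\<lambda>j. x + axis j 1) \<union> range (\<lambda>j. x - axis j 1)"
  proof cases
    case 1
    then have "y = x + axis j 1" using zero by (auto simp: vec_eq_iff axis_def)
    then show ?thesis by blast
  next
    case 2
    then have "y = x - axis j 1" using zero by (auto simp: vec_eq_iff axis_def)
    then show ?thesis by blast
  qed
next
  fix y assume "y \<in> range (\<lambda>j. x + axis j 1) \<union> range (\<lambda>j. x - axis j 1)"
  then obtain j where "y = x + axis j 1 \<or> y = x - axis j 1" by auto
  then have "\<bar>x $ i - y $ i\<bar> = (if i = j then 1 else 0)" for i by (auto simp: axis_def)
  then show "y \<in> neighbours x" by (simp add: neighbours_def)
qed

text \<open>The second shift is written \<open>x + - axis j 1\<close> to match the lemma \<open>fourier_shift\<close>.\<close>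

lemma laplacian_eq:
  fixes u :: "int ^ 'd \<Rightarrow> complex"
  shows "laplacian u x = (\<Sum>j\<in>UNIV. u (x + axis j 1) + u (x + - axis j 1) - 2 * u x)"
proof -
  have inj: "inj (\<lambda>j. x + axis j 1)" "inj (\<lambda>j. x - axis j 1)"
    by (auto simp: inj_def axis_eq_axis)
  have disj: "range (\<lambda>j. x + axis j 1) \<inter> range (\<lambda>j. x - axis j 1) = {}"
  proof -
    have False if "x + axis i 1 = x - axis j 1" for i j
    proof -
      have "axis i (1::int) = - axis j 1"
        using that by (metis add_left_imp_eq diff_conv_add_uminus)
      then have "axis i (1::int) $ i = (- axis j 1) $ i" by (rule arg_cong)
      then show False by (simp add: axis_def split: if_splits)
    qed
    then show ?thesis by blast
  qed
  have "laplacian u x = (\<Sum>y\<in>range (\<lambda>j. x + axis j 1). u y - u x) + (\<Sum>y\<in>range (\<lambda>j. x - axis j 1). u y - u x)"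
    unfolding laplacian_def neighbours_eq using disj by (intro sum.union_disjoint) auto
  also have "\<dots> = (\<Sum>j\<in>UNIV. u (x + axis j 1) - u x) + (\<Sum>j\<in>UNIV. u (x - axis j 1) - u x)"
    using inj by (simp add: sum.reindex)
  also have "\<dots> = (\<Sum>j\<in>UNIV. u (x + axis j 1) + u (x + - axis j 1) - 2 * u x)"
    by (simp add: sum_subtractf sum.distrib)
  finally show ?thesis .
qed

lemma finitely_supported_sum:
  assumes "finite A" "\<And>j. j \<in> A \<Longrightarrow> finitely_supported (f j)"
  shows "finitely_supported (\<lambda>x. \<Sum>j\<in>A. f j x)"
  using assms
proof (induction A rule: finite_induct)
  case empty
  then show ?case by (simp add: finitely_supported_def)
next
  case (insert a A)
  then show ?case using finitely_supported_lincomb[of "f a" "\<lambda>x. \<Sum>j\<in>A. f j x" 1 1] by simp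
qed

lemma fourier_sum:
  assumes "finite A" "\<And>j. j \<in> A \<Longrightarrow> finitely_supported (f j)"
  shows "fourier (\<lambda>x. \<Sum>j\<in>A. f j x) \<xi> = (\<Sum>j\<in>A. fourier (f j) \<xi>)"
  using assms
proof (induction A rule: finite_induct)
  case empty
  then show ?case by (simp add: fourier_def)
next
  case (insert a A)
  then show ?case
    using fourier_lincomb[of "f a" "\<lambda>x. \<Sum>j\<in>A. f j x" 1 1] finitely_supported_sum[of A f] by simp
qed

text \<open>A shift by \<open>axis j 1\<close> multiplies the transform by \<open>exp (\<i> * \<xi> $ j)\<close>; together with the opposite shift
  this gives the factor \<open>2 * cos (\<xi> $ j)\<close>.\<close>

lemma
  fixes u :: "int ^ 'd \<Rightarrow> complex"
  assumes u: "finitely_supported u"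
  shows finitely_supported_laplacian: "finitely_supported (laplacian u)"
    and fourier_laplacian: "fourier (laplacian u) \<xi> = - of_real (symbol \<xi>) * fourier u \<xi>"
proof -
  define s where "s = (\<lambda>j x. 1 * u (x + axis j 1) + 1 * u (x + - axis j 1))"
  define f where "f = (\<lambda>j x. 1 * s j x + (-2) * u x)"
  have eq: "laplacian u = (\<lambda>x. \<Sum>j\<in>UNIV. f j x)"
    by (simp add: laplacian_eq f_def s_def fun_eq_iff)
  have s: "finitely_supported (s j)" for j
    unfolding s_def by (intro finitely_supported_lincomb finitely_supported_shift u)
  have f: "finitely_supported (f j)" for j
    unfolding f_def by (intro finitely_supported_lincomb s u)
  show "finitely_supported (laplacian u)"
    unfolding eq by (intro finitely_supported_sum f) simp
  have comp: "(\<Sum>i\<in>UNIV. of_int (axis j 1 $ i) * \<xi> $ i) = \<xi> $ j" for j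
    by (simp add: axis_def if_distrib if_distribR cong: if_cong)
  have plus: "fourier (\<lambda>x. u (x + axis j 1)) \<xi> = exp (\<i> * of_real (\<xi> $ j)) * fourier u \<xi>" for j
    by (simp only: fourier_shift[OF u] comp)
  have comp': "(\<Sum>i\<in>UNIV. of_int ((- axis j 1) $ i) * \<xi> $ i) = - \<xi> $ j" for j
    using comp[of j] by (simp add: sum_negf)
  have minus: "fourier (\<lambda>x. u (x + - axis j 1)) \<xi> = exp (- (\<i> * of_real (\<xi> $ j))) * fourier u \<xi>" for j
    by (simp only: fourier_shift[OF u] comp' of_real_minus mult_minus_right)
  have "fourier (s j) \<xi> = (exp (\<i> * of_real (\<xi> $ j)) + exp (- (\<i> * of_real (\<xi> $ j)))) * fourier u \<xi>" for j
    unfolding s_def fourier_lincomb[OF finitely_supported_shift[OF u] finitely_supported_shift[OF u]]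
      plus minus by (simp add: algebra_simps)
  moreover have "exp (\<i> * of_real t) + exp (- (\<i> * of_real t)) = complex_of_real (2 * cos t)" for t
    using cos_exp_eq[of "of_real t"] by (simp add: cos_of_real mult.commute)
  ultimately have sj: "fourier (s j) \<xi> = of_real (2 * cos (\<xi> $ j)) * fourier u \<xi>" for j
    by simp
  have fj: "fourier (f j) \<xi> = - of_real (2 - 2 * cos (\<xi> $ j)) * fourier u \<xi>" for j
    unfolding f_def by (subst fourier_lincomb[OF s u]) (simp add: sj algebra_simps)
  have "fourier (laplacian u) \<xi> = (\<Sum>j\<in>UNIV. - of_real (2 - 2 * cos (\<xi> $ j)) * fourier u \<xi>)"
    unfolding eq by (subst fourier_sum) (simp_all only: finite f fj)
  also have "\<dots> = - of_real (symbol \<xi>) * fourier u \<xi>"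
    by (simp only: symbol_def of_real_sum sum_distrib_right sum_negf mult_minus_left)
  finally show "fourier (laplacian u) \<xi> = - of_real (symbol \<xi>) * fourier u \<xi>" .
qed

lemma
  assumes u: "finitely_supported u"
  shows finitely_supported_laplacian_power: "finitely_supported ((laplacian ^^ n) u)"
    and fourier_laplacian_power: "fourier ((laplacian ^^ n) u) \<xi> = (- of_real (symbol \<xi>)) ^ n * fourier u \<xi>"
proof -
  show *: "finitely_supported ((laplacian ^^ n) u)" for n
    by (induction n) (simp_all add: u finitely_supported_laplacian)
  show "fourier ((laplacian ^^ n) u) \<xi> = (- of_real (symbol \<xi>)) ^ n * fourier u \<xi>"
    by (induction n) (simp_all add: fourier_laplacian *)
qed

section \<open>Frullani's integral for the logarithm\<close>

text \<open>For \<open>t > 0\<close> the integrand is the integral of \<open>exp (- (s * t))\<close> over \<open>s\<close> in \<open>{a..b}\<close>. Exchanging the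
  integrals leaves the integral of \<open>1 / s\<close> over \<open>{a..b}\<close>.\<close>

lemma nn_integral_frullani:
  fixes a b :: real
  assumes a: "0 < a" and ab: "a \<le> b"
  shows "(\<integral>\<^sup>+t. ennreal (indicator {0<..} t * ((exp (- (a * t)) - exp (- (b * t))) / t)) \<partial>lborel)
    = ennreal (ln b - ln a)"
proof -
  have inner: "ennreal (indicator {0<..} t * ((exp (- (a * t)) - exp (- (b * t))) / t))
      = (\<integral>\<^sup>+s. ennreal (exp (- (s * t))) * indicator {a..b} s * indicator {0<..} t \<partial>lborel)" for t
  proof (cases "t > 0")
    case True
    have "(\<integral>\<^sup>+s. ennreal (exp (- (s * t))) * indicator {a..b} s \<partial>lborel)
        = - exp (- (b * t)) / t - (- exp (- (a * t)) / t)"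
      using True ab
      by (intro nn_integral_FTC_Icc[where F = "\<lambda>s. - exp (- (s * t)) / t"])
         (auto intro!: derivative_eq_intros)
    with True show ?thesis by (simp add: diff_divide_distrib)
  qed simp
  have outer: "(\<integral>\<^sup>+t. ennreal (exp (- (s * t))) * indicator {a..b} s * indicator {0<..} t \<partial>lborel)
      = ennreal (1 / s) * indicator {a..b} s" for s
  proof (cases "s \<in> {a..b}")
    case True
    then have s: "s > 0" using a by auto
    have "(\<integral>\<^sup>+t. ennreal (exp (- (s * t))) * indicator {0<..} t \<partial>lborel)
        = (\<integral>\<^sup>+t. ennreal (exp (- (s * t))) * indicator {0..} t \<partial>lborel)"
      using AE_lborel_singleton[of "0::real"]
      by (intro nn_integral_cong_AE) (auto simp: indicator_def)
    also have "\<dots> = 0 - (- exp (- (s * 0)) / s)"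
    proof (rule nn_integral_FTC_atLeast)
      show "((\<lambda>t. - exp (- (s * t)) / s) \<longlongrightarrow> 0) at_top"
      proof -
        have "((\<lambda>t. exp (- (s * t))) \<longlongrightarrow> 0) at_top"
          using s by (intro filterlim_compose[OF exp_at_bot] filterlim_compose[OF filterlim_uminus_at_bot_at_top]
              filterlim_tendsto_pos_mult_at_top[OF tendsto_const _ filterlim_ident])
        from tendsto_divide[OF tendsto_minus[OF this] tendsto_const[of s]] s show ?thesis by simp
      qed
    qed (use s in \<open>auto intro!: derivative_eq_intros\<close>)
    finally show ?thesis using True by simp
  qed simp
  have "(\<integral>\<^sup>+t. ennreal (indicator {0<..} t * ((exp (- (a * t)) - exp (- (b * t))) / t)) \<partial>lborel)
     = (\<integral>\<^sup>+t. (\<integral>\<^sup>+s. ennreal (exp (- (s * t))) * indicator {a..b} s * indicator {0<..} t \<partial>lborel) \<partial>lborel)"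
    unfolding inner ..
  also have "\<dots> = (\<integral>\<^sup>+s. (\<integral>\<^sup>+t. ennreal (exp (- (s * t))) * indicator {a..b} s * indicator {0<..} t \<partial>lborel) \<partial>lborel)"
    by (rule lborel_pair.Fubini') measurable
  also have "\<dots> = (\<integral>\<^sup>+s. ennreal (1 / s) * indicator {a..b} s \<partial>lborel)"
    unfolding outer ..
  also have "\<dots> = ln b - ln a"
    using a ab by (intro nn_integral_FTC_Icc) (auto intro!: derivative_eq_intros)
  finally show ?thesis .
qed

definition frullani_kernel :: "real \<Rightarrow> real \<Rightarrow> real" where
  "frullani_kernel a t = indicator {0<..} t * ((exp (- t) - exp (- (a * t))) / t)"

text \<open>For fixed \<open>a\<close> the kernel has constant sign, nonnegative if \<open>a \<ge> 1\<close> and nonpositive if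
  \<open>a \<le> 1\<close>, so its absolute integral is \<open>\<bar>ln a\<bar>\<close>. This is what makes the double integral for
  the logarithmic Laplacian absolutely convergent.\<close>

lemma
  assumes a: "0 < a"
  shows frullani: "has_bochner_integral lborel (frullani_kernel a) (ln a)"
    and frullani_abs: "has_bochner_integral lborel (\<lambda>t. \<bar>frullani_kernel a t\<bar>) \<bar>ln a\<bar>"
proof -
  have [measurable]: "frullani_kernel a \<in> borel_measurable borel"
    unfolding frullani_kernel_def by measurable
  have "has_bochner_integral lborel (frullani_kernel a) (ln a) \<and>
    has_bochner_integral lborel (\<lambda>t. \<bar>frullani_kernel a t\<bar>) \<bar>ln a\<bar>"
  proof (cases "a \<ge> 1")
    case True
    have nonneg: "frullani_kernel a t \<ge> 0" for t
      using True by (auto simp: frullani_kernel_def indicator_def intro!: divide_nonneg_pos)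
    have "has_bochner_integral lborel (frullani_kernel a) (ln a)"
      using True nonneg nn_integral_frullani[of 1 a]
      by (intro has_bochner_integral_nn_integral) (auto simp: frullani_kernel_def)
    with True nonneg show ?thesis by simp
  next
    case False
    have nonneg: "- frullani_kernel a t \<ge> 0" for t
      using False by (auto simp: frullani_kernel_def indicator_def intro!: divide_nonpos_pos)
    then have abs: "\<bar>frullani_kernel a t\<bar> = - frullani_kernel a t" for t by (smt (verit))
    have eq: "- frullani_kernel a t = indicator {0<..} t * ((exp (- (a * t)) - exp (- (1 * t))) / t)" for t
      by (simp add: frullani_kernel_def algebra_simps diff_divide_distrib)
    have *: "has_bochner_integral lborel (\<lambda>t. - frullani_kernel a t) (- ln a)"
      using False a nonneg nn_integral_frullani[of a 1, folded eq]
      by (intro has_bochner_integral_nn_integral) auto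
    from has_bochner_integral_minus[OF *] * False a show ?thesis
      by (simp add: abs)
  qed
  then show "has_bochner_integral lborel (frullani_kernel a) (ln a)"
    "has_bochner_integral lborel (\<lambda>t. \<bar>frullani_kernel a t\<bar>) \<bar>ln a\<bar>" by auto
qed

section \<open>Square integrability of the logarithm of the symbol\<close>

text \<open>Taylor's formula gives \<open>cos x \<le> 1 - x\<^sup>2 / 2 + x ^ 4 / 24\<close>, and \<open>x\<^sup>2 \<le> 10\<close> bounds the quartic
  term by \<open>10 * x\<^sup>2 / 24\<close>.\<close>

lemma two_minus_two_cos_ge:
  fixes x :: real
  assumes "\<bar>x\<bar> \<le> pi"
  shows "x\<^sup>2 / 6 \<le> 2 - 2 * cos x"
proof -
  obtain t where t: "cos x = (\<Sum>m<4. cos_coeff m * x ^ m) + (cos (t + 1/2 * real 4 * pi) / fact 4) * x ^ 4"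
    using Maclaurin_cos_expansion[of x 4] by auto
  have "(\<Sum>m<4. cos_coeff m * x ^ m) = 1 - x\<^sup>2 / 2"
    by (simp add: lessThan_nat_numeral cos_coeff_def power2_eq_square)
  moreover have "(cos (t + 1/2 * real 4 * pi) / fact 4) * x ^ 4 \<le> 1 / fact 4 * x ^ 4"
    by (intro mult_right_mono divide_right_mono) auto
  ultimately have le: "cos x \<le> 1 - x\<^sup>2 / 2 + x ^ 4 / 24"
    using t by (simp add: fact_numeral)
  have "\<bar>x\<bar> * \<bar>x\<bar> \<le> 3.15 * 3.15"
    using assms pi_approx by (intro mult_mono) auto
  then have "x\<^sup>2 \<le> 10" by (simp add: power2_eq_square)
  then have "x\<^sup>2 * x\<^sup>2 \<le> 10 * x\<^sup>2" by (intro mult_right_mono) auto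
  then have "x ^ 4 \<le> 10 * x\<^sup>2" by (simp add: eval_nat_numeral)
  with le show ?thesis by simp
qed

lemma borel_measurable_symbol [measurable]: "symbol \<in> borel_measurable borel"
  unfolding symbol_def by (intro borel_measurable_continuous_onI continuous_intros)

lemma symbol_le: "symbol (\<xi> :: real^'d) \<le> 4 * real CARD('d)"
proof -
  have "symbol \<xi> \<le> (\<Sum>j\<in>(UNIV :: 'd set). 4)"
    unfolding symbol_def
  proof (rule sum_mono)
    show "2 - 2 * cos (\<xi> $ j) \<le> 4" for j using cos_ge_minus_one[of "\<xi> $ j"] by linarith
  qed
  then show ?thesis by simp
qed

lemma symbol_nonneg: "symbol \<xi> \<ge> 0"
  unfolding symbol_def by (intro sum_nonneg) simp

lemma symbol_ge:
  assumes "\<xi> \<in> torus"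
  shows "(\<xi> $ j)\<^sup>2 / 6 \<le> symbol \<xi>"
proof -
  have "(\<xi> $ j)\<^sup>2 / 6 \<le> 2 - 2 * cos (\<xi> $ j)"
    using assms by (intro two_minus_two_cos_ge) (auto simp: torus_def abs_le_iff minus_le_iff)
  also have "\<dots> \<le> symbol \<xi>"
    unfolding symbol_def by (rule member_le_sum[where f = "\<lambda>j. 2 - 2 * cos (\<xi> $ j)"]) auto
  finally show ?thesis .
qed

text \<open>On the torus the symbol vanishes only at the origin.\<close>

lemma AE_symbol_pos: "AE \<xi> in torus_borel. 0 < symbol \<xi>"
proof -
  have "AE \<xi> in lborel. \<xi> \<in> torus \<longrightarrow> 0 < symbol (\<xi> :: real^'d)"
    using AE_lborel_singleton[of "0 :: real^'d"]
  proof eventually_elim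
    case (elim \<xi>)
    then obtain j where "\<xi> $ j \<noteq> 0" by (auto simp: vec_eq_iff)
    then have "0 < (\<xi> $ j)\<^sup>2 / 6" by simp
    with symbol_ge[of \<xi> j] show ?case by linarith
  qed
  then show ?thesis
    unfolding torus_borel_def by (subst AE_restrict_space_iff) auto
qed

text \<open>The logarithm is dominated by any small power. The exponent \<open>- (1/4)\<close> is small enough for the use
  with \<open>y\<close> a multiple of \<open>(\<xi> $ j)\<^sup>2\<close>: it leads to \<open>\<bar>\<xi> $ j\<bar> powr (- (1/2))\<close>, which is integrable at
  \<open>0\<close>.\<close>

lemma ln_square_le:
  fixes y s R :: real
  assumes "0 < y" "y \<le> s" "s \<le> R" "1 \<le> R"
  shows "(ln s)\<^sup>2 \<le> (ln R)\<^sup>2 + 64 * y powr (- (1/4))"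
proof (cases "s \<ge> 1")
  case True
  with assms have "(ln s)\<^sup>2 \<le> (ln R)\<^sup>2" by (intro power_mono) auto
  then show ?thesis by (simp add: add_increasing2)
next
  case False
  have "- ln s \<le> - ln y" using assms by simp
  also have "\<dots> = ln (1 / y)" using assms by (simp add: ln_div)
  also have "\<dots> \<le> (1 / y) powr (1/8) / (1/8)" using assms False by (intro ln_powr_bound) auto
  also have "\<dots> = 8 * y powr (- (1/8))" using assms by (simp add: powr_divide powr_minus_divide)
  finally have "(- ln s)\<^sup>2 \<le> (8 * y powr (- (1/8)))\<^sup>2"
    using False assms by (intro power_mono) auto
  also have "\<dots> = 64 * y powr (- (1/4))"
    by (simp add: power_mult_distrib power2_eq_square flip: powr_add)
  finally show ?thesis by (simp add: add_increasing)
qed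

lemma nn_integral_abs_powr_finite:
  "(\<integral>\<^sup>+t. ennreal (indicator {-pi..pi} t * \<bar>t\<bar> powr (- (1/2))) \<partial>lborel) < \<infinity>"
proof -
  let ?g = "\<lambda>t::real. ennreal (indicator {0..pi} t * t powr (- (1/2)))"
  have "((\<lambda>x. x powr (- (1/2))) has_integral (pi powr (- (1/2) + 1) / (- (1/2) + 1))) {0..pi}"
    by (rule has_integral_powr_from_0) auto
  then have *: "(\<integral>\<^sup>+t. ?g t \<partial>lborel) = ennreal (pi powr (- (1/2) + 1) / (- (1/2) + 1))"
    by (rule nn_integral_has_integral_lebesgue[rotated]) auto
  have "(\<integral>\<^sup>+t. ennreal (indicator {-pi..pi} t * \<bar>t\<bar> powr (- (1/2))) \<partial>lborel)
      \<le> (\<integral>\<^sup>+t. ?g t + ?g (0 + (-1) * t) \<partial>lborel)"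
    by (intro nn_integral_mono) (auto simp: indicator_def abs_if)
  also have "\<dots> = (\<integral>\<^sup>+t. ?g t \<partial>lborel) + (\<integral>\<^sup>+t. ?g (0 + (-1) * t) \<partial>lborel)"
    by (rule nn_integral_add) measurable
  also have "(\<integral>\<^sup>+t. ?g (0 + (-1) * t) \<partial>lborel) = (\<integral>\<^sup>+t. ?g t \<partial>lborel)"
    by (subst nn_integral_real_affine[where c = "-1" and t = 0 and f = ?g]) auto
  also have "(\<integral>\<^sup>+t. ?g t \<partial>lborel) + (\<integral>\<^sup>+t. ?g t \<partial>lborel) < \<infinity>"
    unfolding * by (simp add: less_top[symmetric])
  finally show ?thesis .
qed

text \<open>The symbol is at least \<open>(\<xi> $ j)\<^sup>2 / 6\<close> for one arbitrary coordinate \<open>j\<close>. The resulting bound depends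
  on that coordinate only, and its integral factors into one-dimensional ones. A single coordinate
  suffices because the logarithmic singularity is weak in every dimension.\<close>

lemma integrable_ln_symbol_square:
  "integrable torus_borel (\<lambda>\<xi> :: real^'d. (ln (symbol \<xi>))\<^sup>2)"
proof -
  obtain j :: 'd where True by simp
  let ?b = "axis j 1 :: real^'d"
  define p where "p = (\<lambda>t. indicator {-pi..pi} t * \<bar>t\<bar> powr (- (1/2)) :: real)"
  \<comment> \<open>The singular factor sits in the chosen coordinate, the other factors are indicators.\<close>
  define f where "f = (\<lambda>b t. ennreal (if b = ?b then p t else indicator {-pi..pi} t))"
  have [measurable]: "p \<in> borel_measurable borel" unfolding p_def by measurable
  have [measurable]: "f b \<in> borel_measurable borel" for b unfolding f_def by measurable
  have b: "?b \<in> Basis" by simp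
  have eq: "indicator torus \<xi> * ennreal (\<bar>\<xi> $ j\<bar> powr (- (1/2))) \<le> (\<Prod>b\<in>Basis. f b (\<xi> \<bullet> b))" for \<xi> :: "real^'d"
  proof (cases "\<xi> \<in> torus")
    case True
    then have "\<xi> \<bullet> c \<in> {-pi..pi}" if "c \<in> Basis" for c
      using that by (auto simp: torus_cbox mem_box Basis_vec_def inner_axis)
    then have "(\<Prod>c\<in>Basis - {?b}. f c (\<xi> \<bullet> c)) = 1"
      by (intro prod.neutral) (auto simp: f_def)
    moreover have "f ?b (\<xi> \<bullet> ?b) = ennreal (\<bar>\<xi> $ j\<bar> powr (- (1/2)))"
      using True by (auto simp: f_def p_def inner_axis torus_def)
    ultimately show ?thesis using True by (simp add: prod.remove[OF _ b])
  qed simp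
  have "(\<integral>\<^sup>+\<xi>. ennreal (\<bar>\<xi> $ j\<bar> powr (- (1/2))) \<partial>torus_borel)
      = (\<integral>\<^sup>+\<xi>. indicator torus \<xi> * ennreal (\<bar>\<xi> $ j\<bar> powr (- (1/2))) \<partial>lborel)"
    unfolding torus_borel_def by (subst nn_integral_restrict_space) (auto simp: mult.commute)
  also have "\<dots> \<le> (\<integral>\<^sup>+\<xi>. (\<Prod>b\<in>Basis. f b (\<xi> \<bullet> b)) \<partial>lborel)"
    by (intro nn_integral_mono eq)
  also have "\<dots> = (\<Prod>b\<in>Basis. \<integral>\<^sup>+t. f b t \<partial>lborel)"
    by (rule nn_integral_lborel_prod) auto
  also have "\<dots> < \<infinity>"
  proof -
    have "(\<integral>\<^sup>+t. f b t \<partial>lborel) < \<infinity>" if "b \<in> Basis" for b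
    proof (cases "b = ?b")
      case True
      then show ?thesis using nn_integral_abs_powr_finite by (simp add: f_def p_def)
    next
      case False
      then show ?thesis by (simp add: f_def ennreal_indicator)
    qed
    then show ?thesis by (auto simp: less_top[symmetric] ennreal_prod_eq_top)
  qed
  finally have fin: "(\<integral>\<^sup>+\<xi>. ennreal (\<bar>(\<xi> :: real^'d) $ j\<bar> powr (- (1/2))) \<partial>torus_borel) < \<infinity>" .
  have pow: "integrable torus_borel (\<lambda>\<xi> :: real^'d. \<bar>\<xi> $ j\<bar> powr (- (1/2)))"
  proof (rule integrableI_nonneg)
    show "(\<lambda>\<xi> :: real^'d. \<bar>\<xi> $ j\<bar> powr (- (1/2))) \<in> borel_measurable torus_borel"
      by (rule borel_measurable_torus_borel) measurable
  qed (use fin in auto)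
  let ?R = "4 * real CARD('d)"
  have "1 \<le> CARD('d)" by (simp add: Suc_le_eq)
  then have R: "1 \<le> ?R" by linarith
  show ?thesis
  proof (rule Bochner_Integration.integrable_bound)
    show "integrable torus_borel (\<lambda>\<xi> :: real^'d. (ln ?R)\<^sup>2 + 64 * (6 powr (1/4) * \<bar>\<xi> $ j\<bar> powr (- (1/2))))"
      using pow by (intro Bochner_Integration.integrable_add integrable_mult_right) auto
    show "(\<lambda>\<xi> :: real^'d. (ln (symbol \<xi>))\<^sup>2) \<in> borel_measurable torus_borel"
      by (rule borel_measurable_torus_borel) measurable
    have "AE \<xi> in lborel. \<xi> \<in> torus \<longrightarrow> (ln (symbol \<xi>))\<^sup>2 \<le> (ln ?R)\<^sup>2 + 64 * (6 powr (1/4) * \<bar>(\<xi> :: real^'d) $ j\<bar> powr (- (1/2)))"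
    proof -
      have "(ln (symbol \<xi>))\<^sup>2 \<le> (ln ?R)\<^sup>2 + 64 * (6 powr (1/4) * \<bar>\<xi> $ j\<bar> powr (- (1/2)))"
        if "\<xi> \<in> torus" "\<xi> $ j \<noteq> 0" for \<xi> :: "real^'d"
      proof -
        have sq: "(\<xi> $ j)\<^sup>2 = \<bar>\<xi> $ j\<bar> powr 2" using that by simp
        have "((\<xi> $ j)\<^sup>2 / 6) powr (- (1/4)) = 6 powr (1/4) * \<bar>\<xi> $ j\<bar> powr (- (1/2))"
          unfolding sq
          by (subst powr_divide) (auto simp: powr_powr powr_minus field_simps simp del: powr_numeral)
        then show ?thesis
          using ln_square_le[of "(\<xi> $ j)\<^sup>2 / 6" "symbol \<xi>" ?R] symbol_ge[OF that(1), of j] symbol_le[of \<xi>] R that(2)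
          by simp
      qed
      moreover have "AE \<xi> in lborel. (\<xi> :: real^'d) $ j \<noteq> 0"
      proof -
        have "{\<xi> :: real^'d. \<xi> $ j = 0} \<in> null_sets lebesgue"
          using negligible_standard_hyperplane_cart[of j] by (simp add: negligible_iff_null_sets)
        from AE_not_in[OF this] show ?thesis by (simp add: AE_completion_iff)
      qed
      ultimately show ?thesis by auto
    qed
    then show "AE \<xi> in torus_borel. norm ((ln (symbol \<xi>))\<^sup>2) \<le> norm ((ln ?R)\<^sup>2 + 64 * (6 powr (1/4) * \<bar>(\<xi> :: real^'d) $ j\<bar> powr (- (1/2))))"
      unfolding torus_borel_def by (subst AE_restrict_space_iff) (auto simp: abs_of_nonneg)
  qed
qed

section \<open>Fourier coefficients of the heat semigroup and of the logarithmic Laplacian\<close>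

text \<open>The powers of the Laplacian are multiplications by \<open>(- symbol \<xi>) ^ n\<close> on the Fourier side, so the
  exponential series becomes the series of \<open>exp (- (t * symbol \<xi>))\<close>. As the symbol is bounded, the
  series may be integrated term by term.\<close>

lemma heat_eq_integral:
  fixes u :: "int ^ 'd \<Rightarrow> complex"
  assumes u: "finitely_supported u"
  shows "heat t u x = (\<integral>\<xi>. exp (- (t * symbol \<xi>)) *\<^sub>R (fourier u \<xi> * cnj (character x \<xi>)) \<partial>torus_borel)"
proof -
  define h where "h = (\<lambda>\<xi>. fourier u \<xi> * cnj (character x \<xi>))"
  have [measurable]: "h \<in> borel_measurable borel" unfolding h_def by measurable
  define f where "f = (\<lambda>n \<xi>. ((t * - symbol \<xi>) ^ n / fact n) *\<^sub>R h \<xi>)"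
  have [measurable]: "f n \<in> borel_measurable borel" for n unfolding f_def by measurable
  obtain B where B: "\<And>\<xi>. cmod (fourier u \<xi>) \<le> B" using norm_fourier_le by blast
  let ?c = "(2 * pi) powr (- (real CARD('d) / 2))"
  let ?R = "\<bar>t\<bar> * (4 * real CARD('d))"
  have hB: "cmod (h \<xi>) \<le> B * ?c" for \<xi>
    unfolding h_def using B[of \<xi>] by (simp add: norm_mult norm_character mult_right_mono)
  have fB: "norm (f n \<xi>) \<le> ?R ^ n / fact n * (B * ?c)" for n \<xi>
  proof -
    have "\<bar>t * - symbol \<xi>\<bar> ^ n \<le> ?R ^ n"
      using symbol_nonneg[of \<xi>] symbol_le[of \<xi>] by (intro power_mono) (auto simp: abs_mult intro: mult_left_mono)
    then have "\<bar>t * - symbol \<xi>\<bar> ^ n / fact n * cmod (h \<xi>) \<le> ?R ^ n / fact n * (B * ?c)"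
      by (intro mult_mono hB divide_right_mono) auto
    then show ?thesis by (simp add: f_def power_abs)
  qed
  have summ: "summable (\<lambda>n. ?R ^ n / fact n * C)" for C
    using summable_exp[of ?R] by (intro summable_mult2) (simp add: field_simps)
  have f_int: "integrable torus_borel (f n)" for n
    by (rule torus_integrable_bounded[OF _ fB]) measurable
  have f_summ: "summable (\<lambda>n. norm (f n \<xi>))" for \<xi>
    by (rule summable_comparison_test'[OF summ]) (use fB in auto)
  have int_norm: "(\<integral>\<xi>. norm (f n \<xi>) \<partial>torus_borel) \<le> ?R ^ n / fact n * (B * ?c * measure torus_borel (torus :: (real^'d) set))" for n
  proof -
    have "(\<integral>\<xi>. norm (f n \<xi>) \<partial>torus_borel) \<le> (\<integral>\<xi>. ?R ^ n / fact n * (B * ?c) \<partial>(torus_borel :: (real^'d) measure))"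
      using f_int by (intro integral_mono fB) auto
    then show ?thesis by (simp add: mult_ac)
  qed
  have "(\<lambda>n. integral\<^sup>L torus_borel (f n)) sums (\<integral>\<xi>. (\<Sum>n. f n \<xi>) \<partial>torus_borel)"
  proof (rule sums_integral[OF f_int])
    show "summable (\<lambda>n. \<integral>\<xi>. norm (f n \<xi>) \<partial>torus_borel)"
      by (rule summable_comparison_test'[OF summ]) (use int_norm in auto)
  qed (simp add: f_summ)
  moreover have "integral\<^sup>L torus_borel (f n) = (t ^ n / fact n) *\<^sub>R (laplacian ^^ n) u x" for n
  proof -
    have "f n = (\<lambda>\<xi>. (t ^ n / fact n) *\<^sub>R (fourier ((laplacian ^^ n) u) \<xi> * cnj (character x \<xi>)))"
      unfolding f_def power_mult_distrib
      by (simp add: h_def fourier_laplacian_power[OF u] fun_eq_iff scaleR_conv_of_real)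
    then show ?thesis
      by (simp add: fourier_inversion finitely_supported_laplacian_power u)
  qed
  moreover have "(\<Sum>n. f n \<xi>) = exp (- (t * symbol \<xi>)) *\<^sub>R h \<xi>" for \<xi>
  proof -
    have "(\<lambda>n. (t * - symbol \<xi>) ^ n / fact n) sums exp (t * - symbol \<xi>)"
      using exp_converges[of "t * - symbol \<xi>"] by (simp add: field_simps)
    from sums_unique[OF sums_scaleR_left[OF this, of "h \<xi>"]] show ?thesis by (simp add: f_def)
  qed
  ultimately have "(\<lambda>n. (t ^ n / fact n) *\<^sub>R (laplacian ^^ n) u x) sums (\<integral>\<xi>. exp (- (t * symbol \<xi>)) *\<^sub>R h \<xi> \<partial>torus_borel)"
    by simp
  then show ?thesis unfolding heat_def h_def by (rule sums_unique[symmetric])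
qed

lemma square_integrable_ln_symbol_mult:
  fixes h :: "real ^ 'd \<Rightarrow> complex"
  assumes [measurable]: "h \<in> borel_measurable borel" and B: "\<And>\<xi>. cmod (h \<xi>) \<le> B"
  shows "integrable torus_borel (\<lambda>\<xi>. (cmod (of_real (ln (symbol \<xi>)) * h \<xi>))\<^sup>2)"
proof (rule Bochner_Integration.integrable_bound)
  show "integrable torus_borel (\<lambda>\<xi> :: real^'d. B\<^sup>2 * (ln (symbol \<xi>))\<^sup>2)"
    by (intro integrable_mult_right integrable_ln_symbol_square)
  show "(\<lambda>\<xi>. (cmod (of_real (ln (symbol \<xi>)) * h \<xi>))\<^sup>2) \<in> borel_measurable torus_borel"
    by (rule borel_measurable_torus_borel) measurable
  have "(cmod (h \<xi>))\<^sup>2 \<le> B\<^sup>2" for \<xi> using B by (intro power_mono) auto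
  then show "AE \<xi> in torus_borel. norm ((cmod (of_real (ln (symbol \<xi>)) * h \<xi>))\<^sup>2) \<le> norm (B\<^sup>2 * (ln (symbol \<xi>))\<^sup>2)"
    by (intro AE_I2) (simp add: norm_mult power_mult_distrib abs_mult mult.commute[of "B\<^sup>2"] mult.commute[of "\<bar>_\<bar>\<^sup>2"] mult_mono)
qed

text \<open>Insert the integral formula for the heat semigroup. The integrand is then a Frullani kernel with
  parameter \<open>symbol \<xi>\<close>, and Fubini's theorem moves the integral over \<open>t\<close> inside, where it produces
  the logarithm. Absolute convergence amounts to the integrability of \<open>ln (symbol \<xi>)\<close>.\<close>

lemma log_laplacian_eq_integral:
  fixes u :: "int ^ 'd \<Rightarrow> complex"
  assumes u: "finitely_supported u"
  shows "log_laplacian u x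
    = (\<integral>\<xi>. of_real (ln (symbol \<xi>)) * fourier u \<xi> * cnj (character x \<xi>) \<partial>torus_borel)"
proof -
  define h where "h = (\<lambda>\<xi>. fourier u \<xi> * cnj (character x \<xi>))"
  have [measurable]: "h \<in> borel_measurable borel" unfolding h_def by measurable
  have [measurable]: "h \<in> borel_measurable torus_borel" "symbol \<in> borel_measurable (torus_borel :: (real^'d) measure)"
    by (rule borel_measurable_torus_borel; measurable)+
  obtain B where B: "\<And>\<xi>. cmod (fourier u \<xi>) \<le> B" using norm_fourier_le by blast
  let ?c = "(2 * pi) powr (- (real CARD('d) / 2))"
  have hB: "cmod (h \<xi>) \<le> B * ?c" for \<xi>
    unfolding h_def using B[of \<xi>] by (simp add: norm_mult norm_character mult_right_mono)
  have h_int: "integrable torus_borel h" by (rule torus_integrable_bounded[OF _ hB]) measurable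
  have lnh_int: "integrable torus_borel (\<lambda>\<xi>. of_real (ln (symbol \<xi>)) * h \<xi>)"
    by (intro integrable_of_square_integrable square_integrable_ln_symbol_mult[OF _ hB]) measurable
  interpret P: pair_sigma_finite "torus_borel :: (real^'d) measure" "lborel :: real measure" ..
  define F where "F = (\<lambda>\<xi> t. frullani_kernel (symbol \<xi>) t *\<^sub>R h \<xi>)"
  have F_meas: "case_prod F \<in> borel_measurable (torus_borel \<Otimes>\<^sub>M lborel)"
    unfolding F_def frullani_kernel_def by measurable
  have F_int: "integrable (torus_borel \<Otimes>\<^sub>M lborel) (case_prod F)"
  proof (rule P.Fubini_integrable[OF F_meas])
    have "integrable torus_borel (\<lambda>\<xi>. norm (of_real (ln (symbol \<xi>)) * h \<xi>))"
      using lnh_int by (rule integrable_norm)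
    then show "integrable torus_borel (\<lambda>\<xi>. \<integral>t. norm (case_prod F (\<xi>, t)) \<partial>lborel)"
    proof (rule integrable_cong_AE_imp)
      show "AE \<xi> in torus_borel. norm (of_real (ln (symbol \<xi>)) * h \<xi>) = (\<integral>t. norm (case_prod F (\<xi>, t)) \<partial>lborel)"
        using AE_symbol_pos
      proof eventually_elim
        case (elim \<xi>)
        from has_bochner_integral_integral_eq[OF frullani_abs[OF elim]] show ?case
          by (simp add: F_def norm_mult)
      qed
    qed (use F_meas in measurable)
    show "AE \<xi> in torus_borel. integrable lborel (\<lambda>t. case_prod F (\<xi>, t))"
      using AE_symbol_pos
    proof eventually_elim
      case (elim \<xi>)
      from frullani[OF elim] show ?case by (auto simp: F_def has_bochner_integral_iff)
    qed
  qed
  have "log_laplacian u x = (\<integral>t. (\<integral>\<xi>. F \<xi> t \<partial>torus_borel) \<partial>lborel)"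
    unfolding log_laplacian_def set_lebesgue_integral_def
  proof (rule Bochner_Integration.integral_cong[OF refl])
    fix t :: real
    show "indicator {0<..} t *\<^sub>R ((exp (- t) *\<^sub>R u x - heat t u x) /\<^sub>R t) = (\<integral>\<xi>. F \<xi> t \<partial>torus_borel)"
    proof (cases "t > 0")
      case True
      have e_int: "integrable torus_borel (\<lambda>\<xi>. exp (- (t * symbol \<xi>)) *\<^sub>R h \<xi>)"
      proof (rule torus_integrable_bounded)
        fix \<xi> :: "real^'d"
        have "exp (- (t * symbol \<xi>)) \<le> 1" using True symbol_nonneg[of \<xi>] by simp
        then show "norm (exp (- (t * symbol \<xi>)) *\<^sub>R h \<xi>) \<le> 1 * (B * ?c)"
          using hB[of \<xi>] unfolding norm_scaleR by (intro mult_mono) auto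
      qed measurable
      have "F \<xi> t = (exp (- t) *\<^sub>R h \<xi> - exp (- (t * symbol \<xi>)) *\<^sub>R h \<xi>) /\<^sub>R t" for \<xi>
        using True by (simp add: F_def frullani_kernel_def scaleR_diff_left[symmetric] divide_inverse_commute mult.commute)
      then have "(\<integral>\<xi>. F \<xi> t \<partial>torus_borel)
          = (exp (- t) *\<^sub>R integral\<^sup>L torus_borel h - (\<integral>\<xi>. exp (- (t * symbol \<xi>)) *\<^sub>R h \<xi> \<partial>torus_borel)) /\<^sub>R t"
        using e_int h_int by simp
      with True show ?thesis
        by (simp add: heat_eq_integral[OF u] h_def fourier_inversion[OF u])
    qed (simp add: F_def frullani_kernel_def)
  qed
  also have "\<dots> = (\<integral>\<xi>. (\<integral>t. F \<xi> t \<partial>lborel) \<partial>torus_borel)"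
    by (rule P.Fubini_integral[OF F_int])
  also have "\<dots> = (\<integral>\<xi>. of_real (ln (symbol \<xi>)) * h \<xi> \<partial>torus_borel)"
  proof (rule integral_cong_AE)
    show "AE \<xi> in torus_borel. (\<integral>t. F \<xi> t \<partial>lborel) = of_real (ln (symbol \<xi>)) * h \<xi>"
      using AE_symbol_pos
    proof eventually_elim
      case (elim \<xi>)
      from frullani[OF elim] show ?case by (simp add: F_def has_bochner_integral_iff scaleR_conv_of_real)
    qed
  qed (use F_meas in measurable)
  finally show ?thesis by (simp add: h_def mult.assoc)
qed

section \<open>Approximation of the logarithm by polynomials in the Laplacian\<close>

text \<open>The term for \<open>n = 0\<close> is \<open>1 / 0 = 0\<close>, so the sums are the Taylor polynomials of \<open>- ln (1 - q)\<close>. All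
  terms are nonnegative, hence the polynomials stay between \<open>0\<close> and their limit: this supplies the
  dominating function in the next lemma.\<close>

lemma log_partial_sums:
  fixes q :: real
  assumes "0 \<le> q" "q < 1"
  shows "(\<lambda>k. \<Sum>n<k. q ^ n / real n) \<longlonglongrightarrow> - ln (1 - q)"
    and "(\<Sum>n<k. q ^ n / real n) \<ge> 0"
    and "(\<Sum>n<k. q ^ n / real n) \<le> - ln (1 - q)"
proof -
  have s: "(\<lambda>n. q ^ n / real n) sums - ln (1 - q)"
    using sums_minus[OF ln_series'[of "- q"]] assms by simp
  then show "(\<lambda>k. \<Sum>n<k. q ^ n / real n) \<longlonglongrightarrow> - ln (1 - q)" by (simp add: sums_def)
  show "(\<Sum>n<k. q ^ n / real n) \<ge> 0" using assms by (intro sum_nonneg) auto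
  show "(\<Sum>n<k. q ^ n / real n) \<le> - ln (1 - q)"
    using sum_le_suminf[OF sums_summable[OF s], of "{..<k}"] sums_unique[OF s] assms by auto
qed

text \<open>With \<open>R = 4 * CARD('d)\<close>, an upper bound of the symbol, put \<open>q = 1 - symbol \<xi> / R\<close>. Then
  \<open>ln (symbol \<xi>) = ln R + ln (1 - q)\<close> with \<open>0 \<le> q < 1\<close> almost everywhere. Multiplication by \<open>q\<close> is the
  lattice operator \<open>A v = v + laplacian v / R\<close>, so the Taylor polynomials of the logarithm are the
  multipliers of operators that preserve finite support, and they converge in \<open>L\<^sup>2\<close> by dominated
  convergence.\<close>

lemma L2_approximation:
  fixes u :: "int ^ 'd \<Rightarrow> complex"
  assumes u: "finitely_supported u"
  obtains w where "\<And>k :: nat. finitely_supported (w k)"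
    and "\<And>k. integrable torus_borel (\<lambda>\<xi>. (cmod (fourier (w k) \<xi> - of_real (ln (symbol \<xi>)) * fourier u \<xi>))\<^sup>2)"
    and "(\<lambda>k. \<integral>\<xi>. (cmod (fourier (w k) \<xi> - of_real (ln (symbol \<xi>)) * fourier u \<xi>))\<^sup>2 \<partial>torus_borel) \<longlonglongrightarrow> 0"
proof -
  define R where "R = 4 * real CARD('d)"
  have R: "R > 0" by (simp add: R_def)
  define A where "A = (\<lambda>(v :: int^'d \<Rightarrow> complex) x. 1 * v x + of_real (1 / R) * laplacian v x)"
  have A_step: "finitely_supported (A v)" if "finitely_supported v" for v
    unfolding A_def by (intro finitely_supported_lincomb finitely_supported_laplacian that)
  have A: "finitely_supported ((A ^^ n) u)" for n
    by (induction n) (simp_all add: u A_step)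
  have FA: "fourier ((A ^^ n) u) \<xi> = of_real (1 - symbol \<xi> / R) ^ n * fourier u \<xi>" for n \<xi>
  proof (induction n)
    case (Suc n)
    have "fourier ((A ^^ Suc n) u) \<xi> = fourier (\<lambda>x. 1 * (A ^^ n) u x + of_real (1 / R) * laplacian ((A ^^ n) u) x) \<xi>"
      by (simp add: A_def)
    also have "\<dots> = 1 * fourier ((A ^^ n) u) \<xi> + of_real (1 / R) * fourier (laplacian ((A ^^ n) u)) \<xi>"
      by (rule fourier_lincomb[OF A finitely_supported_laplacian[OF A]])
    also have "\<dots> = of_real (1 - symbol \<xi> / R) * fourier ((A ^^ n) u) \<xi>"
      by (simp add: fourier_laplacian[OF A] algebra_simps)
    finally show ?case by (simp add: Suc)
  qed simp
  define p where "p = (\<lambda>k q. \<Sum>n<k. q ^ n / real n :: real)"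
  \<comment> \<open>The vanishing summands \<open>0 * u x\<close> give every term the shape of a linear combination of two functions.\<close>
  define w where "w = (\<lambda>(k::nat) x. of_real (ln R) * u x + (-1) * (\<Sum>n<k. of_real (1 / real n) * (A ^^ n) u x + 0 * u x))"
  have S: "finitely_supported (\<lambda>x. \<Sum>n<k. of_real (1 / real n) * (A ^^ n) u x + 0 * u x)" for k
    by (intro finitely_supported_sum finitely_supported_lincomb A u) simp
  have w: "finitely_supported (w k)" for k
    unfolding w_def by (intro finitely_supported_lincomb S u)
  have Fw: "fourier (w k) \<xi> = of_real (ln R - p k (1 - symbol \<xi> / R)) * fourier u \<xi>" for k \<xi>
  proof -
    have "fourier (w k) \<xi> = of_real (ln R) * fourier u \<xi> + (-1) * (\<Sum>n<k. of_real (1 / real n) * fourier ((A ^^ n) u) \<xi> + 0 * fourier u \<xi>)"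
      unfolding w_def
      by (subst fourier_lincomb[OF u S], subst fourier_sum)
         (simp_all only: finite_lessThan finitely_supported_lincomb[OF A u] fourier_lincomb[OF A u])
    then show ?thesis
      by (simp add: FA p_def algebra_simps sum_distrib_left sum_negf)
  qed
  define D where "D = (\<lambda>k \<xi>. fourier (w k) \<xi> - of_real (ln (symbol \<xi>)) * fourier u \<xi>)"
  have [measurable]: "D k \<in> borel_measurable borel" for k unfolding D_def by measurable
  have D: "(\<lambda>k. D k \<xi>) \<longlonglongrightarrow> 0" "cmod (D k \<xi>) \<le> \<bar>ln R - ln (symbol \<xi>)\<bar> * cmod (fourier u \<xi>)"
    if "0 < symbol \<xi>" for k \<xi>
  proof -
    define q where "q = 1 - symbol \<xi> / R"
    have q: "0 \<le> q" "q < 1" using that R symbol_le[of \<xi>] by (auto simp: q_def R_def field_simps)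
    have ln: "ln (symbol \<xi>) = ln R + ln (1 - q)" using that R by (simp add: q_def ln_div)
    have Dq: "D k \<xi> = of_real (- ln (1 - q) - p k q) * fourier u \<xi>" for k
      unfolding D_def Fw ln q_def[symmetric] by (simp add: algebra_simps)
    have "(\<lambda>k. of_real (- ln (1 - q) - p k q) * fourier u \<xi>) \<longlonglongrightarrow> of_real (- ln (1 - q) - (- ln (1 - q))) * fourier u \<xi>"
      unfolding p_def by (intro tendsto_intros log_partial_sums q)
    then show "(\<lambda>k. D k \<xi>) \<longlonglongrightarrow> 0" by (simp add: Dq)
    have "\<bar>- ln (1 - q) - p k q\<bar> \<le> \<bar>ln R - ln (symbol \<xi>)\<bar>"
      using log_partial_sums(2,3)[OF q, of k] by (simp add: ln p_def)
    then show "cmod (D k \<xi>) \<le> \<bar>ln R - ln (symbol \<xi>)\<bar> * cmod (fourier u \<xi>)"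
      unfolding Dq norm_mult norm_of_real by (rule mult_right_mono) simp
  qed
  obtain B where B: "\<And>\<xi>. cmod (fourier u \<xi>) \<le> B" using norm_fourier_le by blast
  define W where "W = (\<lambda>\<xi> :: real^'d. B\<^sup>2 * (2 * (ln R)\<^sup>2 + 2 * (ln (symbol \<xi>))\<^sup>2))"
  have W: "integrable torus_borel W"
    unfolding W_def
    by (intro integrable_mult_right Bochner_Integration.integrable_add integrable_ln_symbol_square) simp
  have DW: "AE \<xi> in torus_borel. norm ((cmod (D k \<xi>))\<^sup>2) \<le> W \<xi>" for k
    using AE_symbol_pos
  proof eventually_elim
    case (elim \<xi>)
    have "(cmod (D k \<xi>))\<^sup>2 \<le> (\<bar>ln R - ln (symbol \<xi>)\<bar> * cmod (fourier u \<xi>))\<^sup>2"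
      by (intro power_mono D elim) simp
    also have "\<dots> = (cmod (fourier u \<xi>))\<^sup>2 * (ln R - ln (symbol \<xi>))\<^sup>2"
      by (simp add: power_mult_distrib)
    also have "\<dots> \<le> W \<xi>"
      unfolding W_def
    proof (intro mult_mono)
      show "(cmod (fourier u \<xi>))\<^sup>2 \<le> B\<^sup>2" using B by (intro power_mono) auto
      show "(ln R - ln (symbol \<xi>))\<^sup>2 \<le> 2 * (ln R)\<^sup>2 + 2 * (ln (symbol \<xi>))\<^sup>2"
        using zero_le_power2[of "ln R + ln (symbol \<xi>)"] by (simp add: power2_eq_square algebra_simps)
    qed auto
    finally show ?case by simp
  qed
  have meas: "(\<lambda>\<xi>. (cmod (D k \<xi>))\<^sup>2) \<in> borel_measurable torus_borel" for k
    by (rule borel_measurable_torus_borel) measurable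
  have "(\<lambda>k. \<integral>\<xi>. (cmod (D k \<xi>))\<^sup>2 \<partial>torus_borel) \<longlonglongrightarrow> (\<integral>\<xi>. 0 \<partial>(torus_borel :: (real^'d) measure))"
  proof (rule integral_dominated_convergence[OF _ meas W _ DW])
    show "AE \<xi> in torus_borel. (\<lambda>k. (cmod (D k \<xi>))\<^sup>2) \<longlonglongrightarrow> 0"
      using AE_symbol_pos
    proof eventually_elim
      case (elim \<xi>)
      from tendsto_power[OF tendsto_norm[OF D(1)[OF elim]], of 2] show ?case by simp
    qed
  qed simp
  then have lim: "(\<lambda>k. \<integral>\<xi>. (cmod (D k \<xi>))\<^sup>2 \<partial>torus_borel) \<longlonglongrightarrow> 0" by simp
  have int: "integrable torus_borel (\<lambda>\<xi>. (cmod (D k \<xi>))\<^sup>2)" for k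
    using DW[of k] by (intro Bochner_Integration.integrable_bound[OF W meas]) (auto elim: eventually_mono)
  from that[of w] w int lim show ?thesis by (simp add: D_def)
qed

section \<open>Passage to the closure\<close>

text \<open>A substitute for the triangle inequality in \<open>L\<^sup>2\<close>, sufficient for limits that are \<open>0\<close>.\<close>

lemma integral_square_add_le:
  fixes f g h :: "'a \<Rightarrow> complex"
  assumes f: "integrable M (\<lambda>x. (cmod (f x))\<^sup>2)" and g: "integrable M (\<lambda>x. (cmod (g x))\<^sup>2)"
    and h: "h \<in> borel_measurable M" "\<And>x. h x = f x + g x"
  shows "integrable M (\<lambda>x. (cmod (h x))\<^sup>2)"
    and "(\<integral>x. (cmod (h x))\<^sup>2 \<partial>M) \<le> 2 * (\<integral>x. (cmod (f x))\<^sup>2 \<partial>M) + 2 * (\<integral>x. (cmod (g x))\<^sup>2 \<partial>M)"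
proof -
  have le: "(cmod (h x))\<^sup>2 \<le> 2 * (cmod (f x))\<^sup>2 + 2 * (cmod (g x))\<^sup>2" for x
  proof -
    have "(cmod (h x))\<^sup>2 \<le> (cmod (f x) + cmod (g x))\<^sup>2"
      unfolding h(2) by (intro power_mono norm_triangle_ineq) simp
    then show ?thesis
      using zero_le_power2[of "cmod (f x) - cmod (g x)"] by (simp add: power2_eq_square algebra_simps)
  qed
  have int: "integrable M (\<lambda>x. 2 * (cmod (f x))\<^sup>2 + 2 * (cmod (g x))\<^sup>2)"
    using f g by simp
  show *: "integrable M (\<lambda>x. (cmod (h x))\<^sup>2)"
  proof (rule Bochner_Integration.integrable_bound[OF int])
    show "(\<lambda>x. (cmod (h x))\<^sup>2) \<in> borel_measurable M" using h(1) by measurable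
    show "AE x in M. norm ((cmod (h x))\<^sup>2) \<le> norm (2 * (cmod (f x))\<^sup>2 + 2 * (cmod (g x))\<^sup>2)"
      by (intro AE_I2) (use le in \<open>auto simp: abs_of_nonneg\<close>)
  qed
  have "(\<integral>x. (cmod (h x))\<^sup>2 \<partial>M) \<le> (\<integral>x. 2 * (cmod (f x))\<^sup>2 + 2 * (cmod (g x))\<^sup>2 \<partial>M)"
    by (intro integral_mono * int le)
  also have "\<dots> = 2 * (\<integral>x. (cmod (f x))\<^sup>2 \<partial>M) + 2 * (\<integral>x. (cmod (g x))\<^sup>2 \<partial>M)"
    using f g by simp
  finally show "(\<integral>x. (cmod (h x))\<^sup>2 \<partial>M) \<le> 2 * (\<integral>x. (cmod (f x))\<^sup>2 \<partial>M) + 2 * (\<integral>x. (cmod (g x))\<^sup>2 \<partial>M)" .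
qed

text \<open>If one sequence \<open>w\<close> of finitely supported functions has transforms converging to \<open>g\<close>, and \<open>f\<close> is the
  family of Fourier coefficients of \<open>g\<close>, then \<open>w\<close> converges to \<open>f\<close> by Bessel's inequality. Any other
  sequence \<open>v\<close> converging to \<open>f\<close> is then close to \<open>w\<close>, and Parseval's identity for the finitely
  supported \<open>v n - w k\<close> carries this over to the transforms. Completeness of the exponentials enters
  only through the given sequence \<open>w\<close>.\<close>

lemma has_fourier_transformI:
  fixes f :: "int ^ 'd \<Rightarrow> complex" and g :: "real ^ 'd \<Rightarrow> complex"
  assumes [measurable]: "g \<in> borel_measurable borel"
    and g2: "integrable torus_borel (\<lambda>\<xi>. (cmod (g \<xi>))\<^sup>2)"
    and f: "\<And>x. f x = (\<integral>\<xi>. g \<xi> * cnj (character x \<xi>) \<partial>torus_borel)"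
    and w: "\<And>k :: nat. finitely_supported (w k)"
    and wg_int: "\<And>k. integrable torus_borel (\<lambda>\<xi>. (cmod (fourier (w k) \<xi> - g \<xi>))\<^sup>2)"
    and wg: "(\<lambda>k. \<integral>\<xi>. (cmod (fourier (w k) \<xi> - g \<xi>))\<^sup>2 \<partial>torus_borel) \<longlonglongrightarrow> 0"
  shows "has_fourier_transform f g"
  unfolding has_fourier_transform_def
proof (intro conjI allI impI)
  have f2: "integrable lattice_measure (\<lambda>x. (cmod (f x))\<^sup>2)"
    unfolding f by (intro bessel_lattice g2) measurable
  then show "square_integrable lattice_measure f" by (simp add: square_integrable_def)
  show "square_integrable torus_measure g"
    using g2 by (simp add: square_integrable_def integrable_torus_measure measurable_torus_measure)
  define d where "d = (\<lambda>k. \<integral>\<xi>. (cmod (fourier (w k) \<xi> - g \<xi>))\<^sup>2 \<partial>torus_borel)"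
  have coeff: "w k x - f x = (\<integral>\<xi>. (fourier (w k) \<xi> - g \<xi>) * cnj (character x \<xi>) \<partial>torus_borel)" for k x
  proof -
    obtain B where B: "\<And>\<xi>. cmod (fourier (w k) \<xi>) \<le> B" using norm_fourier_le by blast
    have "integrable torus_borel (\<lambda>\<xi>. fourier (w k) \<xi> * cnj (character x \<xi>))"
      by (intro integrable_mult_character torus_integrable_bounded[OF _ B]) measurable
    moreover have "integrable torus_borel (\<lambda>\<xi>. g \<xi> * cnj (character x \<xi>))"
      by (intro integrable_mult_character integrable_of_square_integrable g2) measurable
    ultimately show ?thesis by (simp add: f fourier_inversion[OF w] left_diff_distrib)
  qed
  have wf: "integrable lattice_measure (\<lambda>x. (cmod (w k x - f x))\<^sup>2)"
    "(\<integral>x. (cmod (w k x - f x))\<^sup>2 \<partial>lattice_measure) \<le> d k" for k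
    unfolding coeff d_def by (intro bessel_lattice wg_int; measurable)+
  fix v :: "nat \<Rightarrow> int ^ 'd \<Rightarrow> complex"
  assume "(\<forall>n. finitely_supported (v n)) \<and> (\<lambda>n. L2_norm lattice_measure (\<lambda>x. v n x - f x)) \<longlonglongrightarrow> 0"
  then have v: "finitely_supported (v n)" and lim: "(\<lambda>n. L2_norm lattice_measure (\<lambda>x. v n x - f x)) \<longlonglongrightarrow> 0" for n
    by auto
  define a where "a = (\<lambda>n. \<integral>x. (cmod (v n x - f x))\<^sup>2 \<partial>lattice_measure)"
  define b where "b = (\<lambda>n. \<integral>\<xi>. (cmod (fourier (v n) \<xi> - g \<xi>))\<^sup>2 \<partial>torus_borel)"
  have a: "a \<longlonglongrightarrow> 0"
    using tendsto_power[OF lim, of 2] by (simp add: a_def L2_norm_def)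
  have vf: "integrable lattice_measure (\<lambda>x. (cmod (v n x - f x))\<^sup>2)" for n
    by (rule integral_square_add_le(1)[OF integrable_finitely_supported_square[OF v[of n]], of "\<lambda>x. - f x"])
       (use f2 in auto)
  have bound: "b n \<le> 4 * a n + 6 * d k" for n k
  proof -
    define z where "z = (\<lambda>x. 1 * v n x + (-1) * w k x)"
    have z: "finitely_supported z" unfolding z_def by (intro finitely_supported_lincomb v w)
    have Fz: "fourier z \<xi> = fourier (v n) \<xi> - fourier (w k) \<xi>" for \<xi>
      unfolding z_def by (subst fourier_lincomb[OF v w]) simp
    have "b n \<le> 2 * (\<integral>\<xi>. (cmod (fourier z \<xi>))\<^sup>2 \<partial>torus_borel) + 2 * d k"
      unfolding b_def d_def
      by (rule integral_square_add_le(2)[OF integrable_fourier_square[of z] wg_int])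
         (auto simp: Fz intro!: borel_measurable_torus_borel)
    also have "(\<integral>\<xi>. (cmod (fourier z \<xi>))\<^sup>2 \<partial>torus_borel) = (\<integral>x. (cmod (z x))\<^sup>2 \<partial>lattice_measure)"
      by (rule fourier_parseval[OF z])
    also have "\<dots> \<le> 2 * a n + 2 * (\<integral>x. (cmod (f x - w k x))\<^sup>2 \<partial>lattice_measure)"
      unfolding a_def
      by (rule integral_square_add_le(2)[OF vf]) (use wf(1)[of k] in \<open>auto simp: z_def norm_minus_commute\<close>)
    also have "(\<integral>x. (cmod (f x - w k x))\<^sup>2 \<partial>lattice_measure) \<le> d k"
      using wf(2)[of k] by (simp add: norm_minus_commute)
    finally show ?thesis by simp
  qed
  \<comment> \<open>In \<open>bound\<close>, let \<open>k\<close> tend to infinity with \<open>n\<close> fixed.\<close>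
  have b_le: "b n \<le> 4 * a n" for n
  proof (rule LIMSEQ_le_const)
    have "(\<lambda>k. 4 * a n + 6 * d k) \<longlonglongrightarrow> 4 * a n + 6 * 0"
      using wg unfolding d_def[symmetric] by (intro tendsto_intros)
    then show "(\<lambda>k. 4 * a n + 6 * d k) \<longlonglongrightarrow> 4 * a n" by simp
  qed (use bound in auto)
  have "b \<longlonglongrightarrow> 0"
  proof (rule tendsto_sandwich[of "\<lambda>_. 0" _ _ "\<lambda>n. 4 * a n"])
    show "(\<lambda>n. 4 * a n) \<longlonglongrightarrow> 0" using tendsto_mult_right_zero[OF a] by simp
  qed (use b_le in \<open>auto simp: b_def\<close>)
  from tendsto_real_sqrt[OF this]
  show "(\<lambda>n. L2_norm torus_measure (\<lambda>\<xi>. fourier (v n) \<xi> - g \<xi>)) \<longlonglongrightarrow> 0"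
    by (simp add: b_def L2_norm_def integral_torus_measure)
qed

theorem proposition4p13:
  fixes u :: "int ^ 'd \<Rightarrow> complex"
  assumes "finitely_supported u"
  shows "has_fourier_transform (log_laplacian u)
           (\<lambda>\<xi>. of_real (ln (symbol \<xi>)) * fourier u \<xi>)"
proof -
  obtain B where B: "\<And>\<xi>. cmod (fourier u \<xi>) \<le> B" using norm_fourier_le by blast
  obtain w where w: "\<And>k :: nat. finitely_supported (w k)"
    "\<And>k. integrable torus_borel (\<lambda>\<xi>. (cmod (fourier (w k) \<xi> - of_real (ln (symbol \<xi>)) * fourier u \<xi>))\<^sup>2)"
    "(\<lambda>k. \<integral>\<xi>. (cmod (fourier (w k) \<xi> - of_real (ln (symbol \<xi>)) * fourier u \<xi>))\<^sup>2 \<partial>torus_borel) \<longlonglongrightarrow> 0"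
    using L2_approximation[OF assms] by blast
  show ?thesis
    by (rule has_fourier_transformI[OF _ square_integrable_ln_symbol_mult[OF _ B] log_laplacian_eq_integral[OF assms] w])
       measurable
qed

end
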